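(* Let $G$ be a metric graph-like space containing infinitely many distinct isolated vertices $v_k$ of finite odd degree. Then there is no current $S\in\mathbf I_1(G)$ whose multiplicity has absolute value one (i.e. $\theta_S=1$) $\mathcal H^1$-almost everywhere on every edge incident to every $v_k$.
   Context: Currents are metric currents in the sense of Ambrosio–Kirchheim; $\mathbf I_1(G)$ is the group of integral $1$-currents in $G$ (integer rectifiable of finite mass, with boundary integer rectifiable of finite mass). For an integer rectifiable current $S$, $\theta_S$ denotes the intrinsic nonnegative integer multiplicity in the rectifiable representation (the absolute value of the signed integer coefficient). A metric graph-like space is the metric completion of a finite or countable one-dimensional length complex obtained by gluing compact intervals along endpoints, with pairwise disjoint edge interiors. Local finiteness at accumulation points is not assumed. An isolated vertex $v$ of finite degree $d$ is assumed to have an ordinary finite star neighborhood: a neighborhood containing no other vertex (nor limit of vertices), consisting, for small $\rho>0$, of $d$ geodesic arms $\gamma_i:[0,\rho]\to G$ with $\gamma_i(0)=v$, parametrized isometrically and meeting only at $v$. The degree is the number of these arms. *)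

theory Defs
  imports "HOL-Analysis.Analysis"
begin

text \<open>
  Metric currents of dimension 0 and 1 after Ambrosio and Kirchheim, \<open>Currents in metric spaces\<close>,
  Acta Math. 185 (2000).  The ambient space is the whole of a type of class \<^class>\<open>metric_space\<close>.
  A 1-current is a function of two arguments \<open>f\<close>, \<open>\<pi>\<close>; only its values for bounded Lipschitz \<open>f\<close>
  and Lipschitz \<open>\<pi>\<close> matter, and no condition is imposed on other arguments.
\<close>

section \<open>Metric currents\<close>

definition lip_fun :: "('a::metric_space \<Rightarrow> real) set" where
  "lip_fun = {p. \<exists>C. C-lipschitz_on UNIV p}"

definition lip_bounded :: "('a::metric_space \<Rightarrow> real) set" where
  "lip_bounded = {f \<in> lip_fun. bounded (range f)}"

definition lip_const :: "('a::metric_space \<Rightarrow> real) \<Rightarrow> real" where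
  "lip_const p = Inf {C. C-lipschitz_on UNIV p}"

type_synonym 'a current0 = "('a \<Rightarrow> real) \<Rightarrow> real"
type_synonym 'a current1 = "('a \<Rightarrow> real) \<Rightarrow> ('a \<Rightarrow> real) \<Rightarrow> real"

definition finite_borel :: "'a::metric_space measure \<Rightarrow> bool" where
  "finite_borel \<mu> \<longleftrightarrow> sets \<mu> = sets borel \<and> finite_measure \<mu>"

definition controls0 :: "'a::metric_space measure \<Rightarrow> 'a current0 \<Rightarrow> bool" where
  "controls0 \<mu> T \<longleftrightarrow> finite_borel \<mu> \<and> (\<forall>f\<in>lip_bounded. \<bar>T f\<bar> \<le> (\<integral>x. \<bar>f x\<bar> \<partial>\<mu>))"

definition controls1 :: "'a::metric_space measure \<Rightarrow> 'a current1 \<Rightarrow> bool" where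
  "controls1 \<mu> T \<longleftrightarrow> finite_borel \<mu> \<and>
     (\<forall>f\<in>lip_bounded. \<forall>p\<in>lip_fun. \<bar>T f p\<bar> \<le> lip_const p * (\<integral>x. \<bar>f x\<bar> \<partial>\<mu>))"

definition metric_current0 :: "'a::metric_space current0 \<Rightarrow> bool" where
  "metric_current0 T \<longleftrightarrow>
     (\<forall>f\<in>lip_bounded. \<forall>g\<in>lip_bounded. \<forall>a b.
        T (\<lambda>x. a * f x + b * g x) = a * T f + b * T g) \<and>
     (\<exists>\<mu>. controls0 \<mu> T)"

text \<open>The four conjunct groups are multilinearity, continuity, locality and finite mass.\<close>

definition metric_current1 :: "'a::metric_space current1 \<Rightarrow> bool" where
  "metric_current1 T \<longleftrightarrow>
     (\<forall>f\<in>lip_bounded. \<forall>g\<in>lip_bounded. \<forall>p\<in>lip_fun. \<forall>a b.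
        T (\<lambda>x. a * f x + b * g x) p = a * T f p + b * T g p) \<and>
     (\<forall>f\<in>lip_bounded. \<forall>p\<in>lip_fun. \<forall>q\<in>lip_fun. \<forall>a b.
        T f (\<lambda>x. a * p x + b * q x) = a * T f p + b * T f q) \<and>
     (\<forall>f\<in>lip_bounded. \<forall>p\<in>lip_fun. \<forall>q C.
        (\<forall>n. C-lipschitz_on UNIV (q n)) \<and> (\<forall>x. (\<lambda>n. q n x) \<longlonglongrightarrow> p x)
          \<longrightarrow> (\<lambda>n. T f (q n)) \<longlonglongrightarrow> T f p) \<and>
     (\<forall>f\<in>lip_bounded. \<forall>p\<in>lip_fun. \<forall>U.
        open U \<and> {x. f x \<noteq> 0} \<subseteq> U \<and> p constant_on U \<longrightarrow> T f p = 0) \<and>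
     (\<exists>\<mu>. controls1 \<mu> T)"

text \<open>The mass measure \<open>\<parallel>T\<parallel>\<close> is the least controlling measure.\<close>

definition mass_measure :: "'a::metric_space current1 \<Rightarrow> 'a measure" where
  "mass_measure T = (THE \<mu>. controls1 \<mu> T \<and>
     (\<forall>\<nu>. controls1 \<nu> T \<longrightarrow> (\<forall>B\<in>sets borel. emeasure \<mu> B \<le> emeasure \<nu> B)))"

definition mass :: "'a::metric_space current1 \<Rightarrow> ennreal" where
  "mass T = emeasure (mass_measure T) UNIV"

definition boundary :: "'a::metric_space current1 \<Rightarrow> 'a current0" where
  "boundary T = (\<lambda>f. T (\<lambda>_. 1) f)"

text \<open>
  The restriction of \<open>T\<close> to a Borel set \<open>A\<close> uses the unique extension of \<open>T\<close> to bounded Borel first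
  arguments, which is the extension by continuity in \<open>L\<^sup>1(\<parallel>T\<parallel>)\<close>.
\<close>

definition restrict_current :: "'a::metric_space current1 \<Rightarrow> 'a set \<Rightarrow> 'a current1" where
  "restrict_current T A = (\<lambda>f p. THE r. \<forall>g.
     (\<forall>n. g n \<in> lip_bounded) \<and>
     (\<lambda>n. \<integral>x. \<bar>g n x - indicator A x * f x\<bar> \<partial>mass_measure T) \<longlonglongrightarrow> 0
       \<longrightarrow> (\<lambda>n. T (g n) p) \<longlonglongrightarrow> r)"

definition pushforward ::
    "('a::metric_space \<Rightarrow> 'b::metric_space) \<Rightarrow> 'a current1 \<Rightarrow> 'b current1" where
  "pushforward \<phi> T = (\<lambda>f p. T (f \<circ> \<phi>) (p \<circ> \<phi>))"

section \<open>One-dimensional Hausdorff measure\<close>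

text \<open>
  As an outer measure.  The normalisation \<open>\<omega>\<^sub>1 / 2\<close> equals 1.
\<close>

definition hausdorff1_size :: "real \<Rightarrow> 'a::metric_space set \<Rightarrow> ennreal" where
  "hausdorff1_size \<delta> A =
     (INF U\<in>{U :: nat \<Rightarrow> 'a set. A \<subseteq> (\<Union>n. U n) \<and> (\<forall>n. bounded (U n) \<and> diameter (U n) \<le> \<delta>)}.
        (\<Sum>n. ennreal (diameter (U n))))"

definition hausdorff1 :: "'a::metric_space set \<Rightarrow> ennreal" where
  "hausdorff1 A = (SUP \<delta>\<in>{0<..}. hausdorff1_size \<delta> A)"

section \<open>Integer rectifiable and integral currents\<close>

definition countably_rectifiable1 :: "'a::metric_space set \<Rightarrow> bool" where
  "countably_rectifiable1 S \<longleftrightarrow>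
     (\<exists>(A :: nat \<Rightarrow> real set) f. (\<forall>n. \<exists>C. C-lipschitz_on (A n) (f n)) \<and>
        hausdorff1 (S - (\<Union>n. f n ` A n)) = 0)"

definition rectifiable_current1 :: "'a::metric_space current1 \<Rightarrow> bool" where
  "rectifiable_current1 T \<longleftrightarrow> metric_current1 T \<and>
     (\<exists>S\<in>sets borel. countably_rectifiable1 S \<and> emeasure (mass_measure T) (- S) = 0) \<and>
     (\<forall>B\<in>sets borel. hausdorff1 B = 0 \<longrightarrow> emeasure (mass_measure T) B = 0)"

text \<open>
  The Euclidean current \<open>\<lbrakk>\<theta>\<rbrakk>\<close> on the line, for \<open>\<theta> \<in> L\<^sup>1(\<real>, \<int>)\<close>.  Lipschitz functions are
  differentiable almost everywhere, so the value of \<^const>\<open>deriv\<close> elsewhere is irrelevant.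
\<close>

definition line_current :: "(real \<Rightarrow> int) \<Rightarrow> real current1" where
  "line_current \<theta> = (\<lambda>f p. \<integral>t. of_int (\<theta> t) * f t * deriv p t \<partial>lebesgue)"

definition integer_rectifiable1 :: "'a::metric_space current1 \<Rightarrow> bool" where
  "integer_rectifiable1 T \<longleftrightarrow> rectifiable_current1 T \<and>
     (\<forall>\<phi> :: 'a \<Rightarrow> real. \<phi> \<in> lip_fun \<longrightarrow> (\<forall>A. open A \<longrightarrow>
        (\<exists>\<theta>. integrable lebesgue (\<lambda>t. real_of_int (\<theta> t)) \<and>
           (\<forall>f\<in>lip_bounded. \<forall>p\<in>lip_fun.
              pushforward \<phi> (restrict_current T A) f p = line_current \<theta> f p))))"

definition integer_rectifiable0 :: "'a::metric_space current0 \<Rightarrow> bool" where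
  "integer_rectifiable0 T \<longleftrightarrow> metric_current0 T \<and>
     (\<exists>A (\<theta> :: 'a \<Rightarrow> int). countable A \<and>
        (\<forall>f\<in>lip_bounded. ((\<lambda>x. of_int (\<theta> x) * f x) has_sum T f) A))"

text \<open>Finite mass is part of \<^const>\<open>metric_current1\<close> and \<^const>\<open>metric_current0\<close>.\<close>

definition integral_current1 :: "'a::metric_space current1 \<Rightarrow> bool" where
  "integral_current1 T \<longleftrightarrow> integer_rectifiable1 T \<and> integer_rectifiable0 (boundary T)"

section \<open>Multiplicity\<close>

definition bilipschitz_on :: "'a::metric_space set \<Rightarrow> ('a \<Rightarrow> 'b::metric_space) \<Rightarrow> bool" where
  "bilipschitz_on K f \<longleftrightarrow> (\<exists>C. C-lipschitz_on K f) \<and>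
     (\<exists>C. \<forall>s\<in>K. \<forall>t\<in>K. dist s t \<le> C * dist (f s) (f t))"

text \<open>
  The push-forward under \<open>\<gamma> : K \<rightarrow> X\<close> of \<open>\<lbrakk>\<theta>\<rbrakk>\<close>, for \<open>\<theta>\<close> supported in \<open>K\<close>.  At almost every point of
  \<open>K\<close> the derivative of \<open>p \<circ> \<gamma>\<close> within \<open>K\<close> exists and agrees with the derivative of any Lipschitz
  extension of \<open>p \<circ> \<gamma>\<close> to the line.
\<close>

definition chart_current ::
    "real set \<Rightarrow> (real \<Rightarrow> 'a::metric_space) \<Rightarrow> (real \<Rightarrow> int) \<Rightarrow> 'a current1" where
  "chart_current K \<gamma> \<theta> = (\<lambda>f p.
     set_lebesgue_integral lebesgue K
       (\<lambda>t. of_int (\<theta> t) * f (\<gamma> t) * vector_derivative (p \<circ> \<gamma>) (at t within K)))"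

text \<open>
  The rectifiable representation \<open>T = (\<Sum>n. \<gamma>\<^sub>n\<^sub>#\<lbrakk>\<theta>\<^sub>n\<rbrakk>)\<close> of an integer rectifiable current, with
  bi-Lipschitz charts on compact sets whose images are pairwise disjoint
  (Ambrosio and Kirchheim, Lemma 4.1 and Theorem 4.5).
\<close>

definition rectifiable_representation ::
    "'a::metric_space current1 \<Rightarrow> (nat \<Rightarrow> real set) \<Rightarrow> (nat \<Rightarrow> real \<Rightarrow> 'a) \<Rightarrow>
     (nat \<Rightarrow> real \<Rightarrow> int) \<Rightarrow> bool" where
  "rectifiable_representation T K \<gamma> \<theta> \<longleftrightarrow>
     (\<forall>n. compact (K n) \<and> bilipschitz_on (K n) (\<gamma> n) \<and>
        integrable lebesgue (\<lambda>t. real_of_int (\<theta> n t)) \<and> (\<forall>t. t \<notin> K n \<longrightarrow> \<theta> n t = 0)) \<and>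
     disjoint_family (\<lambda>n. \<gamma> n ` K n) \<and>
     (\<forall>f\<in>lip_bounded. \<forall>p\<in>lip_fun. (\<lambda>n. chart_current (K n) (\<gamma> n) (\<theta> n) f p) sums T f p) \<and>
     (\<Sum>n. mass (chart_current (K n) (\<gamma> n) (\<theta> n))) = mass T"

text \<open>
  \<open>m\<close> is (a version of) the intrinsic multiplicity \<open>\<theta>\<^sub>T\<close>: the absolute value of the signed integer
  coefficient of a rectifiable representation, transported to the space, and 0 off the charts.
  Every integer rectifiable current has such a version, unique up to an
  \<^const>\<open>hausdorff1\<close>-null set.
\<close>

definition has_multiplicity :: "'a::metric_space current1 \<Rightarrow> ('a \<Rightarrow> nat) \<Rightarrow> bool" where
  "has_multiplicity T m \<longleftrightarrow> (\<exists>K \<gamma> \<theta>. rectifiable_representation T K \<gamma> \<theta> \<and>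
     (\<forall>n. \<forall>t\<in>K n. m (\<gamma> n t) = nat \<bar>\<theta> n t\<bar>) \<and>
     (\<forall>x. x \<notin> (\<Union>n. \<gamma> n ` K n) \<longrightarrow> m x = 0))"

section \<open>Metric graph-like spaces\<close>

text \<open>
  The complex is given by its edges \<open>e i : [0, len i] \<rightarrow> X\<close>, for \<open>i\<close> in a countable index set \<open>I\<close>.
  Loops and multiple edges are allowed.
\<close>

definition edge :: "(nat \<Rightarrow> real) \<Rightarrow> (nat \<Rightarrow> real \<Rightarrow> 'a) \<Rightarrow> nat \<Rightarrow> 'a set" where
  "edge len e i = e i ` {0..len i}"

definition vertices :: "nat set \<Rightarrow> (nat \<Rightarrow> real) \<Rightarrow> (nat \<Rightarrow> real \<Rightarrow> 'a) \<Rightarrow> 'a set" where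
  "vertices I len e = (\<Union>i\<in>I. {e i 0, e i (len i)})"

text \<open>\<open>chain I len e x y L\<close>: a finite concatenation of edge segments of total length \<open>L\<close> joins \<open>x\<close> to \<open>y\<close>.\<close>

inductive chain ::
    "nat set \<Rightarrow> (nat \<Rightarrow> real) \<Rightarrow> (nat \<Rightarrow> real \<Rightarrow> 'a) \<Rightarrow> 'a \<Rightarrow> 'a \<Rightarrow> real \<Rightarrow> bool"
    for I len e where
  refl: "chain I len e x x 0"
| step: "chain I len e x (e i t) (L + \<bar>s - t\<bar>)"
    if "chain I len e x (e i s) L" "i \<in> I" "s \<in> {0..len i}" "t \<in> {0..len i}"

text \<open>
  The metric of the space restricts on the complex to the length metric of the gluing (which must
  therefore be finite), and the complex is dense in the complete ambient space, which is thus its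
  metric completion.
\<close>

definition graph_like_space ::
    "nat set \<Rightarrow> (nat \<Rightarrow> real) \<Rightarrow> (nat \<Rightarrow> real \<Rightarrow> 'a::complete_space) \<Rightarrow> bool" where
  "graph_like_space I len e \<longleftrightarrow>
     (\<forall>i\<in>I. 0 < len i \<and> inj_on (e i) {0<..<len i} \<and>
        e i ` {0<..<len i} \<inter> vertices I len e = {}) \<and>
     disjoint_family_on (\<lambda>i. e i ` {0<..<len i}) I \<and>
     (\<forall>x\<in>\<Union>(edge len e ` I). \<forall>y\<in>\<Union>(edge len e ` I).
        {L. chain I len e x y L} \<noteq> {} \<and> dist x y = Inf {L. chain I len e x y L}) \<and>
     closure (\<Union>(edge len e ` I)) = UNIV"

text \<open>
  \<open>v\<close> is an isolated vertex of degree \<open>d\<close>: some neighbourhood of \<open>v\<close> contains no other vertex and no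
  limit of vertices, and consists of \<open>d\<close> isometric arms of length \<open>\<rho>\<close> meeting only at \<open>v\<close>.
  The arms may be shortened, so one \<open>\<rho>\<close> yields such a neighbourhood for every smaller one.
\<close>

definition isolated_vertex ::
    "nat set \<Rightarrow> (nat \<Rightarrow> real) \<Rightarrow> (nat \<Rightarrow> real \<Rightarrow> 'a::metric_space) \<Rightarrow> 'a \<Rightarrow> nat \<Rightarrow> bool" where
  "isolated_vertex I len e v d \<longleftrightarrow> v \<in> vertices I len e \<and>
     (\<exists>\<rho>>0. \<exists>(\<gamma> :: nat \<Rightarrow> real \<Rightarrow> 'a) N.
        N = insert v (\<Union>j<d. \<gamma> j ` {0..\<rho>}) \<and> v \<in> interior N \<and>
        N \<inter> vertices I len e = {v} \<and> (\<forall>x\<in>N. \<not> x islimpt vertices I len e) \<and>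
        (\<forall>j<d. \<gamma> j 0 = v \<and> (\<forall>s\<in>{0..\<rho>}. \<forall>t\<in>{0..\<rho>}. dist (\<gamma> j s) (\<gamma> j t) = \<bar>s - t\<bar>)) \<and>
        (\<forall>j<d. \<forall>k<d. j \<noteq> k \<longrightarrow> \<gamma> j ` {0..\<rho>} \<inter> \<gamma> k ` {0..\<rho>} = {v}))"

definition incident :: "(nat \<Rightarrow> real) \<Rightarrow> (nat \<Rightarrow> real \<Rightarrow> 'a) \<Rightarrow> nat \<Rightarrow> 'a \<Rightarrow> bool" where
  "incident len e i v \<longleftrightarrow> v \<in> {e i 0, e i (len i)}"

end

theory Submission
  imports Defs
begin

text \<open>
  Near an isolated vertex \<open>v\<close> of odd degree, a current of multiplicity one along the arms must have
  boundary at \<open>v\<close>: each arm contributes \<open>+1\<close> or \<open>-1\<close> to the boundary, and an odd number of signs does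
  not sum to zero.  The boundary of an integral current, on the other hand, is a finite sum of
  integer point masses (\<open>integer_rectifiable0_finite_support\<close>), so it can charge only finitely many of
  the infinitely many vertices.

  To make the first claim precise, take a vertex \<open>v\<close> off the finite support of \<open>\<partial>S\<close> and test \<open>S\<close>
  against functions \<open>p\<close> of the distance to \<open>v\<close> that are constant outside the part \<open>a < dist v x < b\<close>
  of a small ball (\<open>radial_cutoff\<close>).  Such a \<open>p\<close> is zero on the support of \<open>\<partial>S\<close>, hence
  \<open>S(1, p) = \<partial>S(p) = 0\<close>.  The rectifiable representation evaluates the same number
  differently.  On every arm \<open>dist v\<close> is the arc length parameter, so the change of variables formula
  turns the chart integrals into the integral over \<open>a < s < b\<close> of a function \<open>\<Theta>(s)\<close>, the sum over the
  arms of the signed multiplicity at distance \<open>s\<close> (\<open>chart_current_radial_cutoff\<close>).  The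
  charts have disjoint images and the multiplicity is one, so \<open>\<Theta>(s)\<close> is a sum of an odd number of signs
  for almost every \<open>s\<close>, while its integrals over all intervals vanish: a contradiction
  (\<open>no_unit_multiplicity_on_odd_star\<close>).  The signs may vary along an arm, since only
  the parity of their number enters.

  The formula for a single chart needs the derivatives of Lipschitz functions on compact subsets of
  the line to exist almost everywhere (\<open>lipschitz_differentiable_ae\<close>, by Vitali coverings, together
  with \<open>lipschitz_extension\<close>).  The hypothesis on the multiplicity concerns edges rather than arms;
  \<open>arm_in_incident_edge\<close> places each arm inside one edge that ends at the vertex, and
  \<open>negligible_hausdorff1_preimage\<close> passes from Hausdorff measure to the arc length parameter.
\<close>

section \<open>Differentiability of Lipschitz functions on the line\<close>

text \<open>
  The form of Vitali's covering theorem used below: the balls may be required to lie in a given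
  open set, because the cover is fine.
\<close>

lemma vitali_balls_inside_open:
  fixes E :: "'a::euclidean_space set"
  assumes "open U" "E \<subseteq> U"
    and fine: "\<And>x \<delta>. x \<in> E \<Longrightarrow> 0 < \<delta> \<Longrightarrow> \<exists>a r. 0 < r \<and> r < \<delta> \<and> x \<in> ball a r \<and> P (ball a r)"
  obtains \<C> where "countable \<C>" "disjoint \<C>" "negligible (E - \<Union>\<C>)"
    "\<And>B. B \<in> \<C> \<Longrightarrow> open B \<and> B \<subseteq> U \<and> P B"
proof -
  define J where "J = {(a, r). 0 < r \<and> ball a r \<subseteq> U \<and> P (ball a r)}"
  have cover: "\<exists>i. i \<in> J \<and> x \<in> ball (fst i) (snd i) \<and> snd i < \<delta>"
    if x: "x \<in> E" and "0 < \<delta>" for x \<delta>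
  proof -
    obtain \<epsilon> where "\<epsilon> > 0" and \<epsilon>: "ball x \<epsilon> \<subseteq> U"
      using assms x open_contains_ball by blast
    obtain a r where ar: "0 < r" "r < min \<delta> (\<epsilon>/2)" "x \<in> ball a r" "P (ball a r)"
      using fine[OF x, of "min \<delta> (\<epsilon>/2)"] \<open>\<epsilon> > 0\<close> \<open>0 < \<delta>\<close> by auto
    have "ball a r \<subseteq> ball x \<epsilon>"
    proof
      fix y assume "y \<in> ball a r"
      then show "y \<in> ball x \<epsilon>"
        using ar dist_triangle[of x y a] by (auto simp: dist_commute)
    qed
    then show ?thesis using ar \<epsilon> by (intro exI[of _ "(a,r)"]) (auto simp: J_def)
  qed
  obtain C where C: "countable C" "C \<subseteq> J"
     "pairwise (\<lambda>i j. disjnt (ball (fst i) (snd i)) (ball (fst j) (snd j))) C"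
     "negligible (E - (\<Union>i \<in> C. ball (fst i) (snd i)))"
    using Vitali_covering_theorem_balls[of E J fst snd] cover by blast
  let ?C = "(\<lambda>i. ball (fst i) (snd i)) ` C"
  have "disjoint ?C"
    unfolding disjoint_def
  proof (intro ballI impI)
    fix A B assume "A \<in> ?C" "B \<in> ?C" "A \<noteq> B"
    then obtain i j where ij: "i \<in> C" "A = ball (fst i) (snd i)" "j \<in> C" "B = ball (fst j) (snd j)"
      by blast
    with \<open>A \<noteq> B\<close> have "i \<noteq> j" by blast
    from pairwiseD[OF C(3) ij(1,3) this] show "A \<inter> B = {}"
      unfolding ij disjnt_def .
  qed
  moreover have "open B \<and> B \<subseteq> U \<and> P B" if "B \<in> ?C" for B
    using that C(2) unfolding J_def by force
  ultimately show ?thesis using that[of ?C] C(1,4) by simp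
qed

text \<open>
  If \<open>\<mu>\<close> has density at least \<open>q\<close> at arbitrarily small scales around each point of \<open>E\<close>, then the
  disjoint Vitali balls already carry \<open>\<mu>\<close>-mass \<open>q\<close> times the volume of \<open>E\<close>.
\<close>

lemma vitali_lower_bound:
  fixes \<mu> :: "'a::euclidean_space measure"
  assumes \<mu>: "sets \<mu> = sets borel" and U: "open U" "E \<subseteq> U" and E: "E \<in> sets borel"
    and fine: "\<And>x \<delta>. x \<in> E \<Longrightarrow> 0 < \<delta> \<Longrightarrow> \<exists>a r. 0 < r \<and> r < \<delta> \<and> x \<in> ball a r \<and>
                  q * emeasure lborel (ball a r) \<le> emeasure \<mu> (ball a r)"
  shows "q * emeasure lborel E \<le> emeasure \<mu> U"
proof -
  obtain \<C> where C: "countable \<C>" "disjoint \<C>" "negligible (E - \<Union>\<C>)"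
    "\<And>B. B \<in> \<C> \<Longrightarrow> open B \<and> B \<subseteq> U \<and> q * emeasure lborel B \<le> emeasure \<mu> B"
    using vitali_balls_inside_open[OF U,
        of "\<lambda>B. q * emeasure lborel B \<le> emeasure \<mu> B"] fine by blast
  have disj: "disjoint_family_on (\<lambda>B. B) \<C>"
    using C(2) by (auto simp: disjoint_family_on_def disjoint_def)
  have oC: "open (\<Union>\<C>)" using C by blast
  have "emeasure lborel E \<le> emeasure lborel (\<Union>\<C> \<union> (E - \<Union>\<C>))"
    using \<mu> U E oC by (intro emeasure_mono) auto
  also have "\<dots> \<le> emeasure lborel (\<Union>\<C>) + emeasure lborel (E - \<Union>\<C>)"
    using \<mu> U E oC by (intro emeasure_subadditive) auto
  also have "emeasure lborel (E - \<Union>\<C>) = 0"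
    using C(3) E oC by (simp add: negligible_iff_emeasure0)
  also have "emeasure lborel (\<Union>\<C>) + 0 = (\<integral>\<^sup>+B. emeasure lborel B \<partial>count_space \<C>)"
    using emeasure_UN_countable[OF _ C(1) disj, of lborel] C(4) by auto
  finally have "q * emeasure lborel E \<le> q * (\<integral>\<^sup>+B. emeasure lborel B \<partial>count_space \<C>)"
    by (rule mult_left_mono) simp
  also have "\<dots> = (\<integral>\<^sup>+B. q * emeasure lborel B \<partial>count_space \<C>)"
    by (simp add: nn_integral_cmult)
  also have "\<dots> \<le> (\<integral>\<^sup>+B. emeasure \<mu> B \<partial>count_space \<C>)"
    using C(4) by (intro nn_integral_mono) auto
  also have "\<dots> = emeasure \<mu> (\<Union>\<C>)"
    using emeasure_UN_countable[OF _ C(1) disj, of \<mu>] C(4) by (auto simp: \<mu>)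
  also have "\<dots> \<le> emeasure \<mu> U"
    using C(4) by (intro emeasure_mono Union_least) (auto simp: \<mu> U)
  finally show ?thesis .
qed

text \<open>
  The counterpart for densities at most \<open>p\<close>.  The Vitali balls leave a null set of \<open>E\<close> uncovered,
  which \<open>\<mu>\<close> might charge, so only the mass of their union \<open>V\<close> is bounded.  As \<open>V\<close> is open and contains
  almost all of \<open>E\<close>, this still combines with the lower bound.
\<close>

lemma vitali_upper_bound:
  fixes \<mu> :: "'a::euclidean_space measure"
  assumes \<mu>: "sets \<mu> = sets borel" and U: "open U" "E \<subseteq> U"
    and fine: "\<And>x \<delta>. x \<in> E \<Longrightarrow> 0 < \<delta> \<Longrightarrow> \<exists>a r. 0 < r \<and> r < \<delta> \<and> x \<in> ball a r \<and>
                  emeasure \<mu> (ball a r) \<le> p * emeasure lborel (ball a r)"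
  obtains V where "open V" "negligible (E - V)" "emeasure \<mu> V \<le> p * emeasure lborel U"
proof -
  obtain \<C> where C: "countable \<C>" "disjoint \<C>" "negligible (E - \<Union>\<C>)"
    "\<And>B. B \<in> \<C> \<Longrightarrow> open B \<and> B \<subseteq> U \<and> emeasure \<mu> B \<le> p * emeasure lborel B"
    using vitali_balls_inside_open[OF U,
        of "\<lambda>B. emeasure \<mu> B \<le> p * emeasure lborel B"] fine by blast
  have disj: "disjoint_family_on (\<lambda>B. B) \<C>"
    using C(2) by (auto simp: disjoint_family_on_def disjoint_def)
  have "emeasure \<mu> (\<Union>\<C>) = (\<integral>\<^sup>+B. emeasure \<mu> B \<partial>count_space \<C>)"
    using emeasure_UN_countable[OF _ C(1) disj, of \<mu>] C(4) by (auto simp: \<mu>)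
  also have "\<dots> \<le> (\<integral>\<^sup>+B. p * emeasure lborel B \<partial>count_space \<C>)"
    using C(4) by (intro nn_integral_mono) auto
  also have "\<dots> = p * (\<integral>\<^sup>+B. emeasure lborel B \<partial>count_space \<C>)"
    by (simp add: nn_integral_cmult)
  also have "(\<integral>\<^sup>+B. emeasure lborel B \<partial>count_space \<C>) = emeasure lborel (\<Union>\<C>)"
    using emeasure_UN_countable[OF _ C(1) disj, of lborel] C(4) by auto
  also have "p * \<dots> \<le> p * emeasure lborel U"
    using C(4) by (intro mult_left_mono emeasure_mono Union_least) (auto simp: U)
  finally show ?thesis using that[of "\<Union>\<C>"] C by blast
qed

text \<open>
  Lebesgue's argument.  For open \<open>U \<supseteq> A\<close>, with \<open>A\<close> a bounded part of \<open>E\<close>, the upper bound yields an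
  open \<open>V\<close> with \<open>\<mu>(V) \<le> p |U|\<close>, and the lower bound on \<open>A \<inter> V\<close> yields \<open>q |A| \<le> \<mu>(V)\<close>.  Letting \<open>U\<close>
  shrink to \<open>A\<close> gives \<open>q |A| \<le> p |A|\<close>, so \<open>|A| = 0\<close>.
\<close>

lemma negligible_if_density_oscillates:
  fixes \<mu> :: "'a::euclidean_space measure" and p q :: real
  assumes \<mu>: "sets \<mu> = sets borel" and E: "E \<in> sets borel" and "p < q" "0 \<le> p"
    and low: "\<And>x \<delta>. x \<in> E \<Longrightarrow> 0 < \<delta> \<Longrightarrow> \<exists>a r. 0 < r \<and> r < \<delta> \<and> x \<in> ball a r \<and>
                  emeasure \<mu> (ball a r) \<le> ennreal p * emeasure lborel (ball a r)"
    and upp: "\<And>x \<delta>. x \<in> E \<Longrightarrow> 0 < \<delta> \<Longrightarrow> \<exists>a r. 0 < r \<and> r < \<delta> \<and> x \<in> ball a r \<and>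
                  ennreal q * emeasure lborel (ball a r) \<le> emeasure \<mu> (ball a r)"
  shows "negligible E"
proof -
  have "emeasure lborel (E \<inter> ball 0 (real n)) = 0" for n
  proof -
    define A where "A = E \<inter> ball 0 (real n)"
    have A: "A \<in> sets borel" using E by (auto simp: A_def)
    have fin: "emeasure lborel A < \<infinity>"
      using emeasure_mono[of A "ball 0 (real n)" lborel] emeasure_lborel_ball_finite[of 0 "real n"]
      by (auto simp: A_def less_top[symmetric] top_unique)
    have bound: "ennreal q * emeasure lborel A \<le> ennreal p * emeasure lborel U"
      if U: "open U" "A \<subseteq> U" for U
    proof -
      obtain V where V: "open V" "negligible (A - V)" "emeasure \<mu> V \<le> p * emeasure lborel U"
        using vitali_upper_bound[OF \<mu> U, of p] low A_def by blast
      have "emeasure lborel A \<le> emeasure lborel (A \<inter> V) + emeasure lborel (A - V)"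
        using emeasure_subadditive[of "A \<inter> V" lborel "A - V"] A V by (auto simp: Int_Diff_Un)
      also have "emeasure lborel (A - V) = 0"
        using V A by (simp add: negligible_iff_emeasure0)
      finally have "ennreal q * emeasure lborel A \<le> ennreal q * emeasure lborel (A \<inter> V)"
        by (simp add: mult_left_mono)
      also have "\<dots> \<le> emeasure \<mu> V"
        using \<mu> V A upp by (intro vitali_lower_bound) (auto simp: A_def)
      finally show ?thesis using V by simp
    qed
    obtain a where a: "emeasure lborel A = ennreal a" "a \<ge> 0"
      using fin by (cases "emeasure lborel A") auto
    have "q * a \<le> p * a + e" if "e > 0" for e
    proof -
      have e: "e / (p + 1) > 0" using that \<open>0 \<le> p\<close> by simp
      obtain U where U: "open U" "A \<subseteq> U" "emeasure lborel (U - A) < ennreal (e/(p+1))"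
        using outer_regular_lborel[of A "e/(p+1)"] e A by auto
      have "emeasure lborel U \<le> emeasure lborel A + emeasure lborel (U - A)"
        using emeasure_subadditive[of A lborel "U - A"] A U by (auto simp: Un_absorb1)
      also have "\<dots> \<le> ennreal (a + e/(p+1))"
        using U(3) a e by (simp add: ennreal_plus add_left_mono)
      finally have "ennreal p * emeasure lborel U \<le> ennreal p * ennreal (a + e/(p+1))"
        by (rule mult_left_mono) simp
      with bound[OF U(1,2)] have "ennreal q * ennreal a \<le> ennreal p * ennreal (a + e/(p+1))"
        by (simp add: a)
      then have "q * a \<le> p * (a + e/(p+1))"
        using a e \<open>0 \<le> p\<close> \<open>p < q\<close>
        by (simp add: ennreal_mult[symmetric] del: ennreal_plus)
      also have "\<dots> \<le> p * a + e"
        using e that \<open>0 \<le> p\<close> by (simp add: field_simps)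
      finally show ?thesis .
    qed
    then have "q * a \<le> p * a" by (rule field_le_epsilon)
    with \<open>p < q\<close> a have "a = 0" by (simp add: mult_le_cancel_right)
    then show ?thesis using a by (simp add: A_def)
  qed
  then have "negligible (E \<inter> ball 0 (real n))" for n
    using E by (simp add: negligible_iff_emeasure0)
  then have "negligible (\<Union>n. E \<inter> ball 0 (real n))"
    by (intro negligible_countable_Union) auto
  moreover have "(\<Union>n. E \<inter> ball 0 (real n)) = E"
  proof -
    have "\<exists>n. x \<in> ball 0 (real n)" for x :: 'a
      using reals_Archimedean2[of "norm x"] by auto
    then show ?thesis by blast
  qed
  ultimately show ?thesis by simp
qed

lemma emeasure_interval_measure_Ioo:
  fixes a b :: real
  assumes "a < b" "mono F" and cont: "continuous_on UNIV F"
  shows "emeasure (interval_measure F) {a<..<b} = F b - F a"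
proof -
  have m: "x \<le> y \<Longrightarrow> F x \<le> F y" for x y using \<open>mono F\<close> by (auto simp: mono_def)
  have Ioc: "emeasure (interval_measure F) {a<..b} = F b - F a"
    using assms cont m
    by (intro emeasure_interval_measure_Ioc)
       (auto simp: continuous_on_eq_continuous_within continuous_at_imp_continuous_at_within)
  have b0: "emeasure (interval_measure F) {b..b} = 0"
    using emeasure_interval_measure_Icc[of b b F] m cont by simp
  have "emeasure (interval_measure F) {a<..b}
      \<le> emeasure (interval_measure F) {a<..<b} + emeasure (interval_measure F) {b..b}"
    by (rule order_trans[OF emeasure_mono emeasure_subadditive]) (use \<open>a<b\<close> in auto)
  moreover have "emeasure (interval_measure F) {a<..<b} \<le> emeasure (interval_measure F) {a<..b}"
    by (intro emeasure_mono) auto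
  ultimately show ?thesis using Ioc b0 by simp
qed

text \<open>
  The slopes of \<open>F\<close> are the densities of the Stieltjes measure of \<open>F\<close>.  Slopes over open intervals
  around the point, rather than difference quotients at the point, make \<open>E\<close> a countable intersection
  of open sets, hence Borel.
\<close>

lemma negligible_slope_oscillation:
  fixes F :: "real \<Rightarrow> real"
  assumes F: "mono F" "continuous_on UNIV F" and "p < q"
  defines "E \<equiv> {x. \<forall>n. (\<exists>y z. y < x \<and> x < z \<and> z - y < 1 / real (Suc n) \<and> F z - F y < p * (z - y)) \<and>
                       (\<exists>y z. y < x \<and> x < z \<and> z - y < 1 / real (Suc n) \<and> F z - F y > q * (z - y))}"
  shows "negligible E"
proof (cases "E = {}")
  case False
  then obtain x y z where "y < x" "x < z" "F z - F y < p * (z - y)" by (auto simp: E_def)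
  moreover have "F y \<le> F z" using F \<open>y < x\<close> \<open>x < z\<close> by (auto simp: mono_def)
  ultimately have "0 < p * (z - y)" by linarith
  then have "0 < p" using \<open>y < x\<close> \<open>x < z\<close> by (simp add: zero_less_mult_iff)
  let ?U = "\<lambda>Q n. \<Union>{{y<..<z} |y z. z - y < 1 / real (Suc n) \<and> Q (F z - F y) (z - y)}"
  have E_eq: "E = (\<Inter>n. ?U (\<lambda>s t. s < p * t) n) \<inter> (\<Inter>n. ?U (\<lambda>s t. s > q * t) n)"
    unfolding E_def by (auto; metis greaterThanLessThan_iff)
  have "open (?U Q n)" for Q n by (intro open_Union) auto
  then have E: "E \<in> sets borel" unfolding E_eq by (intro sets.Int sets.countable_INT') auto
  have small: "\<exists>n. 1 / real (Suc n) < \<delta>" if "\<delta> > 0" for \<delta> :: real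
    using nat_approx_posE[OF that] by blast
  have ball: "ball ((y+z)/2) ((z-y)/2) = {y<..<z}" for y z :: real
    by (simp add: ball_eq_greaterThanLessThan field_simps)
  have len: "emeasure lborel {y<..<z} = ennreal (z - y)" if "y < z" for y z :: real
    using that by simp
  show ?thesis
  proof (rule negligible_if_density_oscillates[of "interval_measure F" E p q])
    fix x \<delta> :: real assume x: "x \<in> E" and "0 < \<delta>"
    obtain n where n: "1 / real (Suc n) < \<delta>" using small[OF \<open>0 < \<delta>\<close>] by blast
    obtain y z where yz: "y < x" "x < z" "z - y < 1 / real (Suc n)" "F z - F y < p * (z - y)"
      using x unfolding E_def by blast
    then show "\<exists>a r. 0 < r \<and> r < \<delta> \<and> x \<in> ball a r \<and>
        emeasure (interval_measure F) (ball a r) \<le> ennreal p * emeasure lborel (ball a r)"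
      using n F \<open>0 < p\<close>
      by (intro exI[of _ "(y+z)/2"] exI[of _ "(z-y)/2"], unfold ball)
         (auto simp: emeasure_interval_measure_Ioo len ennreal_mult[symmetric])
    obtain y z where yz: "y < x" "x < z" "z - y < 1 / real (Suc n)" "F z - F y > q * (z - y)"
      using x unfolding E_def by blast
    then show "\<exists>a r. 0 < r \<and> r < \<delta> \<and> x \<in> ball a r \<and>
        ennreal q * emeasure lborel (ball a r) \<le> emeasure (interval_measure F) (ball a r)"
      using n F \<open>0 < p\<close> \<open>p < q\<close>
      by (intro exI[of _ "(y+z)/2"] exI[of _ "(z-y)/2"], unfold ball)
         (auto simp: emeasure_interval_measure_Ioo len ennreal_mult[symmetric] intro!: ennreal_leI)
  qed (use E \<open>0 < p\<close> \<open>p < q\<close> in auto)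
qed simp

text \<open>
  Lebesgue's theorem, also the one-dimensional case of Rademacher's.  Adding \<open>C * x\<close> makes the
  function monotone.  Where its difference quotients have no limit they oscillate across some pair of rationals
  \<open>p < q\<close>, and for each pair this happens on a null set only.
\<close>

lemma lipschitz_differentiable_ae:
  fixes f :: "real \<Rightarrow> real"
  assumes "C-lipschitz_on UNIV f"
  shows "negligible {x. \<not> f differentiable (at x)}"
proof -
  define F where "F x = f x + C * x" for x
  have C: "C \<ge> 0" using assms lipschitz_on_nonneg by blast
  have lip: "\<bar>f x - f y\<bar> \<le> C * \<bar>x - y\<bar>" for x y
    using lipschitz_onD[OF assms, of x y] by (simp add: dist_real_def)
  have F_bounds: "0 \<le> F z - F y \<and> F z - F y \<le> 2 * C * (z - y)" if "y \<le> z" for y z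
    using lip[of z y] that by (auto simp: F_def algebra_simps abs_le_iff)
  have "mono F" using F_bounds by (fastforce simp: mono_def)
  have cont: "continuous_on UNIV F"
    unfolding F_def using lipschitz_on_continuous_on[OF assms] by (intro continuous_intros) auto
  define E where "E p q = {x. \<forall>n.
      (\<exists>y z. y < x \<and> x < z \<and> z - y < 1 / real (Suc n) \<and> F z - F y < p * (z - y)) \<and>
      (\<exists>y z. y < x \<and> x < z \<and> z - y < 1 / real (Suc n) \<and> F z - F y > q * (z - y))}" for p q
  let ?R = "{r \<in> \<rat> \<times> \<rat>. fst r < snd r}"
  have "negligible (\<Union>r\<in>?R. E (fst r) (snd r))"
  proof (intro negligible_countable_Union)
    show "countable ((\<lambda>r. E (fst r) (snd r)) ` ?R)"
      by (intro countable_image countable_Collect countable_SIGMA countable_rat)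
    fix A assume "A \<in> (\<lambda>r. E (fst r) (snd r)) ` ?R"
    then obtain r where "A = E (fst r) (snd r)" "fst r < snd r" by blast
    then show "negligible A"
      using negligible_slope_oscillation[OF \<open>mono F\<close> cont, of "fst r" "snd r"] unfolding E_def by simp
  qed
  moreover have "{x. \<not> f differentiable (at x)} \<subseteq> (\<Union>r\<in>?R. E (fst r) (snd r))"
  proof (rule subsetI, rule ccontr)
    fix x assume x: "x \<in> {x. \<not> f differentiable (at x)}"
      and nE: "x \<notin> (\<Union>r\<in>?R. E (fst r) (snd r))"
    define Q where "Q h = (F (x + h) - F x) / h" for h
    \<comment> \<open>By continuity, a strict bound on a slope over an interval with endpoint \<open>x\<close> persists on slightly
      larger intervals, which contain \<open>x\<close> in the interior.  \<open>P s t\<close> stands for a bound on \<open>s / t\<close>.\<close>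
    have straddle: "\<exists>y z. y < x \<and> x < z \<and> z - y < d \<and> P (F z - F y) (z - y)"
      if fr: "\<exists>\<^sub>F h in at 0. P (Q h) 1" and "d > 0"
        and hom: "\<And>s t. t > 0 \<Longrightarrow> P s t \<longleftrightarrow> P (s / t) 1" and op: "open {s. P s 1}" for P d
    proof -
      have "\<forall>\<^sub>F h in at (0::real). \<bar>h\<bar> < d/2"
        using \<open>d > 0\<close> by (intro eventually_at_topological[THEN iffD2] exI[of _ "{-d/2<..<d/2}"]) auto
      moreover have "\<forall>\<^sub>F h in at (0::real). h \<noteq> 0" by (auto simp: eventually_at_filter)
      ultimately obtain h where h: "P (Q h) 1" "\<bar>h\<bar> < d/2" "h \<noteq> 0"
        using frequently_eventually_frequently[OF fr, of "\<lambda>h. \<bar>h\<bar> < d/2 \<and> h \<noteq> 0"]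
        by (auto simp: eventually_conj_iff dest: frequently_ex)
      define lo hi where "lo = min x (x + h)" and "hi = max x (x + h)"
      have order: "lo < hi" "lo \<le> x" "x \<le> hi" "hi - lo = \<bar>h\<bar>"
        using h(3) by (auto simp: lo_def hi_def)
      have isc: "isCont F y" for y using cont by (simp add: continuous_on_eq_continuous_at)
      have "((\<lambda>\<eta>. (F (hi + \<eta>) - F (lo - \<eta>)) / (hi + \<eta> - (lo - \<eta>))) \<longlongrightarrow>
             (F (hi + 0) - F (lo - 0)) / (hi + 0 - (lo - 0))) (at_right 0)"
        using order(1) by (intro tendsto_intros isCont_tendsto_compose[OF isc]) auto
      moreover have "(F (hi + 0) - F (lo - 0)) / (hi + 0 - (lo - 0)) = Q h"
        using h(3) by (cases "h > 0") (auto simp: lo_def hi_def Q_def field_simps)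
      ultimately have "\<forall>\<^sub>F \<eta> in at_right 0. P ((F (hi + \<eta>) - F (lo - \<eta>)) / (hi + \<eta> - (lo - \<eta>))) 1"
        using topological_tendstoD[OF _ op] h(1) by fastforce
      moreover have "\<forall>\<^sub>F \<eta> in at_right (0::real). \<eta> < d/4"
        using \<open>d > 0\<close> by (intro eventually_at_rightI[of 0 "d/4"]) auto
      moreover have "\<forall>\<^sub>F \<eta> in at_right (0::real). \<eta> > 0"
        by (rule eventually_at_right_less)
      ultimately have "\<forall>\<^sub>F \<eta> in at_right 0.
          P ((F (hi + \<eta>) - F (lo - \<eta>)) / (hi + \<eta> - (lo - \<eta>))) 1 \<and> \<eta> < d/4 \<and> \<eta> > 0"
        by (simp add: eventually_conj_iff)
      then obtain \<eta> where \<eta>: "P ((F (hi + \<eta>) - F (lo - \<eta>)) / (hi + \<eta> - (lo - \<eta>))) 1" "\<eta> < d/4" "\<eta> > 0"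
        by (metis (mono_tags, lifting) eventually_happens trivial_limit_at_right_real)
      show ?thesis
      proof (intro exI conjI)
        show "P (F (hi + \<eta>) - F (lo - \<eta>)) (hi + \<eta> - (lo - \<eta>))"
          using \<eta> order(1) hom[of "hi + \<eta> - (lo - \<eta>)"] by simp
      qed (use \<eta> order h(2) in auto)
    qed
    have no_osc: False if "p < q" "\<exists>\<^sub>F h in at 0. Q h < p" "\<exists>\<^sub>F h in at 0. Q h > q" for p q
    proof -
      obtain p' where p': "p < p'" "p' < q" "p' \<in> \<rat>" using Rats_dense_in_real[OF \<open>p<q\<close>] by blast
      obtain q' where q': "p' < q'" "q' < q" "q' \<in> \<rat>" using Rats_dense_in_real[OF p'(2)] by blast
      have "\<exists>\<^sub>F h in at 0. Q h < p' * 1" "\<exists>\<^sub>F h in at 0. Q h > q' * 1"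
        using p' q' by (auto intro: frequently_elim1[OF that(2)] frequently_elim1[OF that(3)])
      note freq = this
      have "\<exists>y z. y < x \<and> x < z \<and> z - y < d \<and> F z - F y < p' * (z - y)" if "d > 0" for d
        by (rule straddle[OF _ that]) (use freq in \<open>auto simp: field_simps open_Collect_less\<close>)
      moreover have "\<exists>y z. y < x \<and> x < z \<and> z - y < d \<and> F z - F y > q' * (z - y)" if "d > 0" for d
        by (rule straddle[OF _ that]) (use freq in \<open>auto simp: field_simps open_Collect_less\<close>)
      ultimately have "x \<in> E p' q'"
        unfolding E_def by simp
      then show False using nE p' q' by force
    qed
    have Q_bounds: "\<forall>\<^sub>F h in at 0. 0 \<le> Q h \<and> Q h \<le> 2 * C"
    proof (rule eventually_at_filter[THEN iffD2], rule always_eventually, intro allI impI)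
      fix h :: real assume "h \<noteq> 0"
      then show "0 \<le> Q h \<and> Q h \<le> 2 * C"
        using F_bounds[of x "x+h"] F_bounds[of "x+h" x]
        by (cases "h > 0") (auto simp: Q_def field_simps zero_le_divide_iff)
    qed
    \<comment> \<open>\<open>Sup L\<close> is the lower limit of the quotients; without oscillation it is also the upper limit.\<close>
    define L where "L = {p. \<forall>\<^sub>F h in at 0. p \<le> Q h}"
    have L0: "0 \<in> L" using Q_bounds unfolding L_def by (auto elim: eventually_mono)
    have Lb: "p \<le> 2 * C" if "p \<in> L" for p
    proof -
      have "\<forall>\<^sub>F h in at 0. p \<le> Q h \<and> 0 \<le> Q h \<and> Q h \<le> 2 * C"
        using that Q_bounds unfolding L_def by (simp add: eventually_conj_iff)
      then obtain h where "p \<le> Q h" "Q h \<le> 2 * C"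
        using eventually_happens'[OF at_neq_bot] by blast
      then show ?thesis by simp
    qed
    have bdd: "bdd_above L" using Lb by (auto simp: bdd_above_def)
    have "(Q \<longlongrightarrow> Sup L) (at 0)"
    proof (rule tendstoI)
      fix \<epsilon> :: real assume "\<epsilon> > 0"
      obtain p where p: "p \<in> L" "Sup L - \<epsilon> < p"
        using less_cSupD[of L "Sup L - \<epsilon>"] L0 \<open>\<epsilon> > 0\<close> by fastforce
      have "\<forall>\<^sub>F h in at 0. Q h \<le> Sup L + \<epsilon> / 2"
      proof (rule ccontr)
        assume "\<not> ?thesis"
        then have 1: "\<exists>\<^sub>F h in at 0. Q h > Sup L + \<epsilon> / 2"
          by (simp add: not_eventually not_le)
        have "Sup L + \<epsilon> / 4 \<notin> L"
          using cSup_upper[OF _ bdd, of "Sup L + \<epsilon> / 4"] \<open>\<epsilon> > 0\<close> by auto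
        then have "\<exists>\<^sub>F h in at 0. Q h < Sup L + \<epsilon> / 4"
          by (simp add: L_def not_eventually not_le)
        from no_osc[OF _ this 1] \<open>\<epsilon> > 0\<close> show False by simp
      qed
      moreover have "\<forall>\<^sub>F h in at 0. p \<le> Q h" using p by (simp add: L_def)
      ultimately show "\<forall>\<^sub>F h in at 0. dist (Q h) (Sup L) < \<epsilon>"
        by eventually_elim (use p \<open>\<epsilon> > 0\<close> in \<open>auto simp: dist_real_def\<close>)
    qed
    then have "(F has_real_derivative Sup L) (at x)"
      unfolding DERIV_def Q_def .
    then have "((\<lambda>x. F x - C * x) has_real_derivative Sup L - C) (at x)"
      by (intro DERIV_diff DERIV_cmult_Id)
    then have "f differentiable (at x)"
      unfolding F_def by (auto simp: real_differentiable_def)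
    with x show False by simp
  qed
  ultimately show ?thesis by (rule negligible_subset)
qed

section \<open>Change of variables along Lipschitz functions\<close>

lemma lipschitz_deriv_bound:
  fixes U :: "real \<Rightarrow> real"
  assumes "L-lipschitz_on UNIV U" "U differentiable (at t)"
  shows "\<bar>deriv U t\<bar> \<le> L"
proof -
  have D: "((\<lambda>h. (U (t + h) - U t) / h) \<longlongrightarrow> deriv U t) (at 0)"
    using assms(2) DERIV_deriv_iff_real_differentiable by (auto simp: DERIV_def)
  have "\<bar>(U (t + h) - U t) / h\<bar> \<le> L" if "h \<noteq> 0" for h
    using lipschitz_onD[OF assms(1), of "t+h" t] that by (simp add: dist_real_def field_simps)
  then have "\<forall>\<^sub>F h in at 0. \<bar>(U (t + h) - U t) / h\<bar> \<le> L"
    by (auto simp: eventually_at_filter)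
  then show ?thesis
    by (rule tendsto_upperbound[OF tendsto_rabs[OF D]]) simp
qed

lemma borel_measurable_deriv_on:
  fixes U :: "real \<Rightarrow> real"
  assumes "continuous_on UNIV U" "G \<in> sets lebesgue" "\<And>t. t \<in> G \<Longrightarrow> U differentiable (at t)"
  shows "(\<lambda>t. indicator G t * deriv U t) \<in> borel_measurable lebesgue"
proof (rule borel_measurable_LIMSEQ_real)
  fix t
  show "(\<lambda>n. indicator G t * ((U (t + 1 / real (Suc n)) - U t) / (1 / real (Suc n))))
     \<longlonglongrightarrow> indicator G t * deriv U t"
  proof (cases "t \<in> G")
    case True
    then have "((\<lambda>h. (U (t + h) - U t) / h) \<longlongrightarrow> deriv U t) (at 0)"
      using assms(3) DERIV_deriv_iff_real_differentiable by (auto simp: DERIV_def)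
    moreover have "filterlim (\<lambda>n. 1 / real (Suc n)) (at 0) sequentially"
      by (intro filterlim_atI LIMSEQ_inverse_real_of_nat[unfolded inverse_eq_divide]) auto
    ultimately have "(\<lambda>n. (U (t + 1 / real (Suc n)) - U t) / (1 / real (Suc n))) \<longlonglongrightarrow> deriv U t"
      by (rule filterlim_compose)
    then show ?thesis using True by simp
  qed simp
next
  fix n
  have "continuous_on UNIV (\<lambda>t. (U (t + 1 / real (Suc n)) - U t) / (1 / real (Suc n)))"
    using assms(1) by (intro continuous_intros continuous_on_compose2[OF assms(1)]) auto
  then have "(\<lambda>t. (U (t + 1 / real (Suc n)) - U t) / (1 / real (Suc n))) \<in> borel_measurable lebesgue"
    by (intro measurable_completion) (simp add: borel_measurable_continuous_onI)
  then show "(\<lambda>t. indicator G t * ((U (t + 1 / real (Suc n)) - U t) / (1 / real (Suc n))))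
      \<in> borel_measurable lebesgue"
    using assms(2) by (intro borel_measurable_times borel_measurable_indicator) auto
qed

text \<open>
  Sard's theorem on the line, read off from the change of variables formula: the set of critical
  values has measure \<open>\<integral> \<bar>U'\<bar> = 0\<close>, the integral being over the critical points.
\<close>

lemma negligible_critical_values:
  fixes U :: "real \<Rightarrow> real"
  assumes lip: "L-lipschitz_on UNIV U" and G: "G \<in> sets lebesgue"
    and diff: "\<And>t. t \<in> G \<Longrightarrow> U differentiable (at t)" and inj: "inj_on U G"
  shows "negligible (U ` {t \<in> G. deriv U t = 0})"
proof -
  let ?S = "{t \<in> G. deriv U t = 0}"
  have "(\<lambda>t. indicator G t * deriv U t) \<in> borel_measurable lebesgue"
    using lipschitz_on_continuous_on[OF lip] G diff by (rule borel_measurable_deriv_on)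
  then have "{t. indicator G t * deriv U t = 0} \<inter> G \<in> sets lebesgue"
    using G by (auto intro!: sets.Int simp: measurable_sets_borel
        dest: measurable_sets[of _ lebesgue borel "{0}"] simp: vimage_def)
  moreover have "{t. indicator G t * deriv U t = 0} \<inter> G = ?S" by auto
  ultimately have S: "?S \<in> sets lebesgue" by simp
  have der: "(U has_field_derivative deriv U t) (at t within ?S)" if "t \<in> ?S" for t
  proof -
    have "U differentiable (at t)" using that diff by blast
    then show ?thesis
      by (rule has_field_derivative_at_within[OF DERIV_deriv_iff_real_differentiable[THEN iffD2]])
  qed
  have "(\<lambda>t. \<bar>deriv U t\<bar> * 1) absolutely_integrable_on ?S \<and> integral ?S (\<lambda>t. \<bar>deriv U t\<bar> * 1) = 0"
  proof
    have "(\<lambda>t. indicator ?S t *\<^sub>R (\<bar>deriv U t\<bar> * 1)) = (\<lambda>_. 0)"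
      by (auto simp: fun_eq_iff indicator_def)
    then show "(\<lambda>t. \<bar>deriv U t\<bar> * 1) absolutely_integrable_on ?S"
      by (simp add: set_integrable_def)
    have "integral ?S (\<lambda>t. \<bar>deriv U t\<bar> * 1) = integral ?S (\<lambda>_. 0)"
      by (rule integral_cong) simp
    then show "integral ?S (\<lambda>t. \<bar>deriv U t\<bar> * 1) = 0" by simp
  qed
  then have *: "(\<lambda>_. 1::real) absolutely_integrable_on (U ` ?S)" "integral (U ` ?S) (\<lambda>_. 1::real) = 0"
    using has_absolute_integral_change_of_variables_1'[OF S der inj_on_subset[OF inj], of "\<lambda>_. 1" 0]
    by auto
  then have "U ` ?S \<in> lmeasurable"
    by (simp add: lmeasurable_iff_integrable_on absolutely_integrable_on_def)
  then show ?thesis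
    using *(2) by (simp add: lmeasure_integral[symmetric] negligible_iff_measure)
qed

text \<open>
  The density on the line of the push-forward of the current \<open>\<lbrakk>w\<rbrakk>\<close> on \<open>G\<close> under an injective map \<open>U\<close>.
  The sign records whether \<open>U\<close> preserves or reverses the orientation.
\<close>

definition transported_density :: "real set \<Rightarrow> (real \<Rightarrow> real) \<Rightarrow> (real \<Rightarrow> real) \<Rightarrow> real \<Rightarrow> real" where
  "transported_density G U w s =
     (if s \<in> U ` G then w (inv_into G U s) * sgn (deriv U (inv_into G U s)) else 0)"

text \<open>
  The change of variables formula for \<open>\<bar>U'\<bar>\<close>, with the sign of \<open>U'\<close> moved into the density:
  \<open>\<bar>U' t\<bar> * transported_density G U w (U t) = w t * U' t\<close>.
\<close>

lemma transported_density_change_of_variables: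
  fixes U w :: "real \<Rightarrow> real"
  assumes lip: "L-lipschitz_on UNIV U" and G: "G \<in> sets lebesgue"
    and diff: "\<And>t. t \<in> G \<Longrightarrow> U differentiable (at t)" and inj: "inj_on U G"
    and w: "integrable lebesgue w" and B: "B \<in> sets borel"
  shows "set_integrable lebesgue (G \<inter> U -` B) (\<lambda>t. w t * deriv U t)"
    and "set_integrable lebesgue B (transported_density G U w)"
    and "set_lebesgue_integral lebesgue (G \<inter> U -` B) (\<lambda>t. w t * deriv U t) =
           set_lebesgue_integral lebesgue B (transported_density G U w)"
proof -
  let ?S = "G \<inter> U -` B" and ?f = "transported_density G U w"
  have contU: "continuous_on UNIV U" by (rule lipschitz_on_continuous_on[OF lip])
  have "U -` B \<in> sets borel"
    using borel_measurable_continuous_onI[OF contU] B measurable_sets_borel by blast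
  then have S: "?S \<in> sets lebesgue" using G by (intro sets.Int) auto
  have L: "0 \<le> L" by (rule lipschitz_on_nonneg[OF lip])
  show 1: "set_integrable lebesgue ?S (\<lambda>t. w t * deriv U t)"
    unfolding set_integrable_def
  proof (rule Bochner_Integration.integrable_bound)
    show "integrable lebesgue (\<lambda>t. L * w t)" using w by simp
    have "(\<lambda>t. indicator ?S t * deriv U t) \<in> borel_measurable lebesgue"
      using contU S diff by (intro borel_measurable_deriv_on) auto
    from borel_measurable_times[OF borel_measurable_integrable[OF w] this]
    show "(\<lambda>t. indicator ?S t *\<^sub>R (w t * deriv U t)) \<in> borel_measurable lebesgue"
      by (simp add: mult_ac)
    have "\<bar>w t\<bar> * \<bar>deriv U t\<bar> \<le> \<bar>w t\<bar> * L" if "t \<in> G" for t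
      using lipschitz_deriv_bound[OF lip diff[OF that]] by (intro mult_left_mono) auto
    then show "AE t in lebesgue. norm (indicator ?S t *\<^sub>R (w t * deriv U t)) \<le> norm (L * w t)"
      using L by (intro always_eventually) (auto simp: indicator_def abs_mult mult.commute)
  qed
  have f: "\<bar>deriv U t\<bar> * ?f (U t) = w t * deriv U t" if "t \<in> ?S" for t
    using that inj by (auto simp: transported_density_def abs_mult_sgn mult_ac)
  have der: "(U has_field_derivative deriv U t) (at t within ?S)" if "t \<in> ?S" for t
  proof -
    have "U differentiable (at t)" using that diff by blast
    then show ?thesis
      by (rule has_field_derivative_at_within[OF DERIV_deriv_iff_real_differentiable[THEN iffD2]])
  qed
  have i: "(\<lambda>t. \<bar>deriv U t\<bar> * ?f (U t)) absolutely_integrable_on ?S"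
    using 1 set_integrable_cong[where M = lebesgue and A = ?S, OF HOL.refl HOL.refl f] by simp
  have cov: "?f absolutely_integrable_on (U ` ?S) \<and>
      integral (U ` ?S) ?f = integral ?S (\<lambda>t. \<bar>deriv U t\<bar> * ?f (U t))"
    using has_absolute_integral_change_of_variables_1'[OF S der, of ?f "integral ?S (\<lambda>t. \<bar>deriv U t\<bar> * ?f (U t))"]
      i inj by (auto intro: inj_on_subset)
  have ind: "(\<lambda>s. indicator (U ` ?S) s *\<^sub>R ?f s) = (\<lambda>s. indicator B s *\<^sub>R ?f s)"
    by (auto simp: fun_eq_iff indicator_def transported_density_def)
  show "set_integrable lebesgue B ?f"
    using cov ind by (simp add: set_integrable_def)
  have "set_lebesgue_integral lebesgue ?S (\<lambda>t. w t * deriv U t) = integral ?S (\<lambda>t. w t * deriv U t)"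
    using 1 by (rule set_lebesgue_integral_eq_integral(2))
  also have "\<dots> = integral ?S (\<lambda>t. \<bar>deriv U t\<bar> * ?f (U t))"
    using f by (intro integral_cong) simp
  also have "\<dots> = set_lebesgue_integral lebesgue (U ` ?S) ?f"
    using cov set_lebesgue_integral_eq_integral(2)[of "U ` ?S" ?f] by simp
  also have "\<dots> = set_lebesgue_integral lebesgue B ?f"
    using ind by (simp add: set_lebesgue_integral_def)
  finally show "set_lebesgue_integral lebesgue ?S (\<lambda>t. w t * deriv U t) =
      set_lebesgue_integral lebesgue B ?f" .
qed

section \<open>Charts near the centre of a star\<close>

text \<open>
  McShane's extension \<open>g(x) = inf\<^sub>t (f(t) + L d(x,t))\<close>.
\<close>

lemma lipschitz_extension:
  fixes f :: "'a::metric_space \<Rightarrow> real"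
  assumes "L-lipschitz_on K f"
  obtains g where "L-lipschitz_on UNIV g" "\<And>x. x \<in> K \<Longrightarrow> g x = f x"
proof (cases "K = {}")
  case True
  then show ?thesis using that[of "\<lambda>_. 0"] lipschitz_on_nonneg[OF assms]
    by (simp add: lipschitz_on_def)
next
  case False
  then obtain k where k: "k \<in> K" by blast
  define g where "g x = (INF t\<in>K. f t + L * dist x t)" for x
  have L: "L \<ge> 0" by (rule lipschitz_on_nonneg[OF assms])
  have lip: "\<bar>f s - f t\<bar> \<le> L * dist s t" if "s \<in> K" "t \<in> K" for s t
    using lipschitz_onD[OF assms that] by (simp add: dist_real_def)
  have bdd: "bdd_below ((\<lambda>t. f t + L * dist x t) ` K)" for x
  proof (rule bdd_belowI2[of _ "f k - L * dist x k"])
    fix t assume t: "t \<in> K"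
    have "L * dist k t \<le> L * dist x k + L * dist x t"
      using L mult_left_mono[OF dist_triangle3[of k t x] L] by (simp add: algebra_simps)
    then show "f k - L * dist x k \<le> f t + L * dist x t"
      using lip[OF k t] by linarith
  qed
  have step: "g x \<le> g y + L * dist x y" for x y
  proof -
    have "g x - L * dist x y \<le> f t + L * dist y t" if t: "t \<in> K" for t
    proof -
      have "g x \<le> f t + L * dist x t" unfolding g_def by (rule cINF_lower[OF bdd t])
      moreover have "L * dist x t \<le> L * dist x y + L * dist y t"
        using mult_left_mono[OF dist_triangle[of x t y] L] by (simp add: algebra_simps)
      ultimately show ?thesis by linarith
    qed
    then have "g x - L * dist x y \<le> g y"
      unfolding g_def[of y] using False by (intro cINF_greatest) auto
    then show ?thesis by simp
  qed
  show ?thesis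
  proof (rule that[of g])
    show "L-lipschitz_on UNIV g"
      using step L by (intro lipschitz_onI; simp add: dist_real_def abs_le_iff algebra_simps) (metis add.commute dist_commute)
    fix x assume x: "x \<in> K"
    have "f x \<le> g x"
      unfolding g_def using lip[OF x] False by (intro cINF_greatest) (force simp: abs_le_iff)+
    moreover have "g x \<le> f x" unfolding g_def using cINF_lower[OF bdd x, of x] by simp
    ultimately show "g x = f x" by simp
  qed
qed

text \<open>
  At an isolated point of the parameter set of a chart the derivative within the set is meaningless;
  countability allows these points to be discarded.
\<close>

lemma countable_isolated_points:
  fixes K :: "'a::second_countable_topology set"
  shows "countable {x \<in> K. \<not> x islimpt K}"
proof -
  obtain B :: "'a set set" where B: "countable B" "topological_basis B"
    using ex_countable_basis by blast
  let ?I = "{x \<in> K. \<not> x islimpt K}"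
  have "\<exists>b\<in>B. b \<inter> K = {x}" if x: "x \<in> ?I" for x
  proof -
    obtain U where U: "open U" "x \<in> U" "\<And>y. y \<in> K \<Longrightarrow> y \<in> U \<Longrightarrow> y = x"
      using x by (auto simp: islimpt_def)
    obtain b where "b \<in> B" "x \<in> b" "b \<subseteq> U" by (rule topological_basisE[OF B(2) U(1,2)])
    then show ?thesis using U x by (intro bexI[of _ b]) auto
  qed
  then obtain b where b: "\<And>x. x \<in> ?I \<Longrightarrow> b x \<in> B \<and> b x \<inter> K = {x}" by metis
  have "inj_on b ?I"
  proof (rule inj_onI)
    fix x y assume "x \<in> ?I" "y \<in> ?I" "b x = b y"
    then have "{x} = {y}" using b by metis
    then show "x = y" by simp
  qed
  moreover have "countable (b ` ?I)" using b by (intro countable_subset[OF _ B(1)]) blast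
  ultimately show ?thesis using countable_image_inj_on by blast
qed

text \<open>
  The ball of radius \<open>r\<close> around \<open>v\<close> as a union of \<open>d\<close> arms, each parametrised by the distance to \<open>v\<close>.
  The separation of the arms excludes the parameter 0, at which all of them pass through \<open>v\<close>.
\<close>

definition metric_star :: "'a::metric_space \<Rightarrow> real \<Rightarrow> nat \<Rightarrow> (nat \<Rightarrow> real \<Rightarrow> 'a) \<Rightarrow> bool" where
  "metric_star v r d \<alpha> \<longleftrightarrow> 0 < r \<and>
     (\<forall>j<d. continuous_on {0..r} (\<alpha> j) \<and> (\<forall>s\<in>{0..r}. dist v (\<alpha> j s) = s)) \<and>
     (\<forall>j<d. \<forall>k<d. \<forall>s\<in>{0<..r}. \<forall>t\<in>{0..r}. \<alpha> j s = \<alpha> k t \<longrightarrow> j = k) \<and>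
     (\<forall>x. dist v x \<le> r \<longrightarrow> (\<exists>j<d. \<exists>s\<in>{0..r}. x = \<alpha> j s))"

text \<open>
  The shift by \<open>b\<close> makes the function vanish outside the ball of radius \<open>b\<close>.
\<close>

definition radial_cutoff :: "'a::metric_space \<Rightarrow> real \<Rightarrow> real \<Rightarrow> 'a \<Rightarrow> real" where
  "radial_cutoff v a b = (\<lambda>x. min (max (dist v x) a) b - b)"

lemma lipschitz_radial_cutoff: "1-lipschitz_on UNIV (radial_cutoff v a b)"
proof (rule lipschitz_onI)
  fix x y
  have "\<bar>dist v x - dist v y\<bar> \<le> dist x y"
    using abs_dist_diff_le[of x v y] by (simp add: dist_commute)
  then show "dist (radial_cutoff v a b x) (radial_cutoff v a b y) \<le> 1 * dist x y"
    by (auto simp: radial_cutoff_def dist_real_def)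
qed simp

text \<open>
  Near the star, the composite \<open>u\<close> of a chart with \<open>dist v\<close> reads off the position on the arms.
  It is injective on the part of the chart in each single arm, so the change of variables applies to
  each arm separately.  The density \<open>\<epsilon> j\<close> transported to arm \<open>j\<close> does not depend on \<open>a\<close> and \<open>b\<close>, it lives
  where the chart meets the arm, and there its absolute value is almost everywhere that of the coefficient \<open>\<theta>\<close>.
\<close>

lemma chart_current_radial_cutoff:
  fixes \<gamma> :: "real \<Rightarrow> 'a::metric_space"
  assumes star: "metric_star v r d \<alpha>" and K: "compact K" and bl: "bilipschitz_on K \<gamma>"
    and w: "integrable lebesgue (\<lambda>t. real_of_int (\<theta> t))"
  obtains \<epsilon> where "\<And>j. j < d \<Longrightarrow> integrable lebesgue (\<epsilon> j)"
    and "\<And>j s. j < d \<Longrightarrow> \<epsilon> j s \<noteq> 0 \<Longrightarrow> 0 < s \<and> s < r \<and> \<alpha> j s \<in> \<gamma> ` K"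
    and "AE s in lebesgue. \<forall>j<d. \<forall>t\<in>K. 0 < s \<and> s < r \<and> \<gamma> t = \<alpha> j s \<longrightarrow> \<bar>\<epsilon> j s\<bar> = \<bar>of_int (\<theta> t)\<bar>"
    and "\<And>a b. 0 \<le> a \<Longrightarrow> a < b \<Longrightarrow> b \<le> r \<Longrightarrow>
           chart_current K \<gamma> \<theta> (\<lambda>_. 1) (radial_cutoff v a b) =
             (\<Sum>j<d. set_lebesgue_integral lebesgue {a<..<b} (\<epsilon> j))"
proof -
  obtain C where C: "C-lipschitz_on K \<gamma>" using bl unfolding bilipschitz_on_def by blast
  obtain C' where C': "\<And>s t. s \<in> K \<Longrightarrow> t \<in> K \<Longrightarrow> dist s t \<le> C' * dist (\<gamma> s) (\<gamma> t)"
    using bl unfolding bilipschitz_on_def by blast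
  have inj: "inj_on \<gamma> K"
    using C' by (intro inj_onI) (metis dist_self mult_zero_right dist_le_zero_iff)
  have "C-lipschitz_on K (\<lambda>t. dist v (\<gamma> t))"
  proof (rule lipschitz_onI)
    fix s t assume "s \<in> K" "t \<in> K"
    then show "dist (dist v (\<gamma> s)) (dist v (\<gamma> t)) \<le> C * dist s t"
      using lipschitz_onD[OF C] abs_dist_diff_le[of "\<gamma> s" v "\<gamma> t"]
      by (fastforce simp: dist_real_def dist_commute)
  qed (rule lipschitz_on_nonneg[OF C])
  then obtain U where lip: "C-lipschitz_on UNIV U" and U: "\<And>t. t \<in> K \<Longrightarrow> U t = dist v (\<gamma> t)"
    using lipschitz_extension by metis
  have contU: "continuous_on UNIV U" by (rule lipschitz_on_continuous_on[OF lip])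
  define D where "D = {t \<in> K. t islimpt K \<and> U differentiable (at t)}"
  have "K - D \<subseteq> {t \<in> K. \<not> t islimpt K} \<union> {t. \<not> U differentiable (at t)}"
    by (auto simp: D_def)
  moreover have "negligible {t \<in> K. \<not> t islimpt K}"
    using countable_imp_null_set_lborel[OF countable_isolated_points]
    by (auto simp: negligible_iff_null_sets intro: null_sets_completionI)
  ultimately have negD: "negligible (K - D)"
    using negligible_Un[OF _ lipschitz_differentiable_ae[OF lip]] negligible_subset by blast
  have "D = K - (K - D)" by (auto simp: D_def)
  moreover have "K \<in> sets lebesgue" using K by (simp add: borel_compact)
  moreover have "K - D \<in> sets lebesgue" by (rule negligible_imp_sets[OF negD])
  ultimately have D: "D \<in> sets lebesgue" by (metis sets.Diff)
  have arm: "continuous_on {0..r} (\<alpha> j)" "\<And>s. s \<in> {0..r} \<Longrightarrow> dist v (\<alpha> j s) = s" if "j < d" for j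
    using star that unfolding metric_star_def by blast+
  have disj: "j = k" if "j < d" "k < d" "0 < s" "s \<le> r" "t \<in> {0..r}" "\<alpha> j s = \<alpha> k t" for j k s t
  proof -
    have "s \<in> {0<..r}" using that by simp
    then show ?thesis using star that(1,2,5,6) unfolding metric_star_def by blast
  qed
  have cover: "\<exists>j<d. x = \<alpha> j (dist v x)" if "dist v x \<le> r" for x
    using star that arm unfolding metric_star_def by metis
  \<comment> \<open>The good parameters whose points lie on arm \<open>j\<close>; the centre is left out, being on every arm.\<close>
  define G where "G j = D \<inter> {t \<in> K. \<gamma> t \<in> \<alpha> j ` {0..r}} \<inter> {t. 0 < U t \<and> U t < r}" for j
  have GK: "G j \<subseteq> K" "G j \<subseteq> D" for j by (auto simp: G_def)
  have G: "G j \<in> sets lebesgue" if "j < d" for j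
  proof -
    have "closed (K \<inter> \<gamma> -` (\<alpha> j ` {0..r}))"
      using lipschitz_on_continuous_on[OF C] K arm(1)[OF that]
      by (intro continuous_closed_preimage compact_imp_closed compact_continuous_image) auto
    moreover have "K \<inter> \<gamma> -` (\<alpha> j ` {0..r}) = {t \<in> K. \<gamma> t \<in> \<alpha> j ` {0..r}}" by auto
    moreover have "open {t. 0 < U t \<and> U t < r}"
      using contU by (intro open_Collect_conj open_Collect_less) auto
    ultimately show ?thesis
      unfolding G_def using D by (intro sets.Int) (auto simp: borel_closed borel_open)
  qed
  have diff: "U differentiable (at t)" if "t \<in> G j" for j t using that GK by (auto simp: D_def)
  have Ginj: "inj_on U (G j)" if j: "j < d" for j
  proof (rule inj_onI)
    fix s t assume st: "s \<in> G j" "t \<in> G j" "U s = U t"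
    then obtain p q where "p \<in> {0..r}" "\<gamma> s = \<alpha> j p" "q \<in> {0..r}" "\<gamma> t = \<alpha> j q"
      unfolding G_def by blast
    then have "\<gamma> s = \<gamma> t" using arm(2)[OF j] st U GK by (metis subsetD)
    then show "s = t" using inj st GK by (meson inj_onD subsetD)
  qed
  let ?w = "\<lambda>t. real_of_int (\<theta> t)"
  define \<epsilon> where "\<epsilon> j = transported_density (G j) U ?w" for j
  have cov: "set_integrable lebesgue (G j \<inter> U -` B) (\<lambda>t. ?w t * deriv U t)"
      "set_integrable lebesgue B (\<epsilon> j)"
      "set_lebesgue_integral lebesgue (G j \<inter> U -` B) (\<lambda>t. ?w t * deriv U t) =
         set_lebesgue_integral lebesgue B (\<epsilon> j)"
    if "j < d" "B \<in> sets borel" for j B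
    using transported_density_change_of_variables[OF lip G[OF that(1)] diff[where j = j] Ginj[OF that(1)] w that(2)]
    unfolding \<epsilon>_def by blast+
  show ?thesis
  proof (rule that[of \<epsilon>])
    fix j assume j: "j < d"
    show "integrable lebesgue (\<epsilon> j)"
      using cov(2)[OF j, of UNIV] by (simp add: set_integrable_def)
    fix s assume "\<epsilon> j s \<noteq> 0"
    then obtain t where t: "t \<in> G j" "s = U t" by (auto simp: \<epsilon>_def transported_density_def split: if_splits)
    then obtain p where "p \<in> {0..r}" "\<gamma> t = \<alpha> j p" unfolding G_def by blast
    then have "\<gamma> t = \<alpha> j s" using arm(2)[OF j] U t GK by (metis subsetD)
    moreover have "t \<in> K" "0 < s" "s < r" using t by (auto simp: G_def)
    ultimately show "0 < s \<and> s < r \<and> \<alpha> j s \<in> \<gamma> ` K" by (metis imageI)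
  next
    \<comment> \<open>The exceptional positions: images of bad parameters, and critical values, where the sign is 0.\<close>
    define Z where "Z = U ` (K - D) \<union> (\<Union>j<d. U ` {t \<in> G j. deriv U t = 0})"
    have "negligible (U ` (K - D))"
    proof (rule negligible_locally_Lipschitz_image[OF _ negD])
      fix x
      show "\<exists>T B. open T \<and> x \<in> T \<and> (\<forall>y\<in>(K - D) \<inter> T. norm (U y - U x) \<le> B * norm (y - x))"
        using lipschitz_onD[OF lip] by (intro exI[of _ UNIV] exI[of _ C]) (auto simp: dist_norm)
    qed simp
    moreover have "negligible (\<Union>j<d. U ` {t \<in> G j. deriv U t = 0})"
      using negligible_critical_values[OF lip G diff Ginj] by (intro negligible_Union) auto
    ultimately have "negligible Z" unfolding Z_def by (rule negligible_Un)
    then have "AE s in lebesgue. s \<notin> Z"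
      by (intro AE_not_in) (simp add: negligible_iff_null_sets)
    then show "AE s in lebesgue. \<forall>j<d. \<forall>t\<in>K. 0 < s \<and> s < r \<and> \<gamma> t = \<alpha> j s \<longrightarrow> \<bar>\<epsilon> j s\<bar> = \<bar>?w t\<bar>"
    proof (eventually_elim, intro allI ballI impI)
      fix s j t assume s: "s \<notin> Z" and j: "j < d" and t: "t \<in> K" "0 < s \<and> s < r \<and> \<gamma> t = \<alpha> j s"
      have Ut: "U t = s" using U[OF t(1)] arm(2)[OF j, of s] t(2) by simp
      have "t \<in> D" using s t(1) Ut unfolding Z_def by blast
      then have tG: "t \<in> G j" using t Ut by (auto simp: G_def)
      have "deriv U t \<noteq> 0" using s tG Ut j unfolding Z_def by blast
      moreover have "inv_into (G j) U s = t" using inv_into_f_f[OF Ginj[OF j] tG] Ut by simp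
      moreover have "s \<in> U ` G j" using tG Ut by blast
      ultimately show "\<bar>\<epsilon> j s\<bar> = \<bar>?w t\<bar>"
        by (simp add: \<epsilon>_def transported_density_def abs_mult abs_sgn_eq)
    qed
  next
    fix a b :: real assume ab: "0 \<le> a" "a < b" "b \<le> r"
    let ?p = "radial_cutoff v a b"
    let ?J = "U -` {a<..<b}"
    let ?R = "\<lambda>t. \<Sum>j<d. indicator (G j \<inter> ?J) t *\<^sub>R (?w t * deriv U t)"
    let ?L = "\<lambda>t. indicator K t *\<^sub>R (?w t * 1 * vector_derivative (?p \<circ> \<gamma>) (at t within K))"
    have transform: "(?p \<circ> \<gamma> has_vector_derivative y) (at t within K)"
      if "(g has_vector_derivative y) (at t within K)" "t \<in> K" "g t = (?p \<circ> \<gamma>) t"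
        "\<forall>\<^sub>F x in at t within K. g x = (?p \<circ> \<gamma>) x" for g y t
      using has_derivative_transform_eventually[of g _ t K "?p \<circ> \<gamma>"] that
      unfolding has_vector_derivative_def by blast
    \<comment> \<open>The cutoff has corners at distances \<open>a\<close> and \<open>b\<close>; each arm meets these spheres only once.\<close>
    have fin: "finite {t \<in> K. U t = c}" if c: "c \<in> {0..r}" for c
    proof (rule inj_on_finite[of \<gamma>])
      show "inj_on \<gamma> {t \<in> K. U t = c}" by (rule inj_on_subset[OF inj]) auto
      show "\<gamma> ` {t \<in> K. U t = c} \<subseteq> (\<lambda>j. \<alpha> j c) ` {..<d}"
        using cover U c by fastforce
    qed simp
    have der: "vector_derivative (?p \<circ> \<gamma>) (at t within K) = (if U t \<in> {a<..<b} then deriv U t else 0)"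
      if t: "t \<in> D" "U t \<noteq> a" "U t \<noteq> b" for t
    proof (rule vector_derivative_within)
      show "at t within K \<noteq> bot" using t by (simp add: D_def trivial_limit_within)
      have tK: "t \<in> K" using t by (simp add: D_def)
      have p: "(?p \<circ> \<gamma>) x = min (max (U x) a) b - b" if "x \<in> K" for x
        using U[OF that] by (simp add: radial_cutoff_def)
      have "isCont U t" using contU by (simp add: continuous_on_eq_continuous_at)
      then have tend: "(U \<longlongrightarrow> U t) (at t within K)"
        using continuous_at_imp_continuous_at_within continuous_within by blast
      have inK: "\<forall>\<^sub>F x in at t within K. x \<in> K" by (simp add: eventually_at_filter)
      consider "U t < a" | "b < U t" | "a < U t" "U t < b" using t by linarith
      then show "(?p \<circ> \<gamma> has_vector_derivative (if U t \<in> {a<..<b} then deriv U t else 0)) (at t within K)"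
      proof cases
        case 1
        have "\<forall>\<^sub>F x in at t within K. a - b = (?p \<circ> \<gamma>) x"
          using order_tendstoD(2)[OF tend 1] inK by eventually_elim (use p ab in auto)
        then have "(?p \<circ> \<gamma> has_vector_derivative 0) (at t within K)"
          using p[OF tK] 1 ab tK by (intro transform[of "\<lambda>_. a - b"]) auto
        then show ?thesis using 1 by simp
      next
        case 2
        have "\<forall>\<^sub>F x in at t within K. 0 = (?p \<circ> \<gamma>) x"
          using order_tendstoD(1)[OF tend 2] inK by eventually_elim (use p ab in auto)
        then have "(?p \<circ> \<gamma> has_vector_derivative 0) (at t within K)"
          using p[OF tK] 2 ab tK by (intro transform[of "\<lambda>_. 0"]) auto
        then show ?thesis using 2 by simp
      next
        case 3
        have "(U has_vector_derivative deriv U t) (at t)"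
          using t DERIV_deriv_iff_real_differentiable has_real_derivative_iff_has_vector_derivative
          unfolding D_def by blast
        then have "((\<lambda>x. U x - b) has_vector_derivative deriv U t) (at t within K)"
          using has_vector_derivative_diff[OF has_vector_derivative_at_within has_vector_derivative_const]
          by force
        moreover have "\<forall>\<^sub>F x in at t within K. U x - b = (?p \<circ> \<gamma>) x"
          using order_tendstoD(1)[OF tend 3(1)] order_tendstoD(2)[OF tend 3(2)] inK
          by eventually_elim (use p in auto)
        ultimately have "(?p \<circ> \<gamma> has_vector_derivative deriv U t) (at t within K)"
          using p[OF tK] 3 tK by (intro transform[of "\<lambda>x. U x - b"]) auto
        then show ?thesis using 3 by simp
      qed
    qed
    have "?R t = ?L t" if t: "t \<notin> (K - D) \<union> ({t \<in> K. U t = a} \<union> {t \<in> K. U t = b})" for t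
    proof (cases "t \<in> K")
      case False
      then show ?thesis using GK by (auto simp: indicator_def)
    next
      case True
      then have tD: "t \<in> D" "U t \<noteq> a" "U t \<noteq> b" using t by auto
      show ?thesis
      proof (cases "U t \<in> {a<..<b}")
        case False
        then show ?thesis using der[OF tD] by auto
      next
        case J: True
        then obtain j where j: "j < d" "\<gamma> t = \<alpha> j (U t)" using cover[of "\<gamma> t"] U[OF True] ab by auto
        have "t \<in> G k \<longleftrightarrow> k = j" if "k < d" for k
          using j J ab True tD(1) disj[OF j(1) that, of "U t"] unfolding G_def by fastforce
        then have "?R t = (\<Sum>k<d. if k = j then ?w t * deriv U t else 0)"
          using J by (intro sum.cong) (auto simp: indicator_def)
        also have "\<dots> = ?w t * deriv U t" using j by simp
        finally show ?thesis using der[OF tD] J True by simp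
      qed
    qed
    moreover have "AE t in lebesgue. t \<notin> (K - D) \<union> ({t \<in> K. U t = a} \<union> {t \<in> K. U t = b})"
    proof (intro AE_not_in negligible_iff_null_sets[THEN iffD1] negligible_Un negD)
      show "negligible {t \<in> K. U t = a}" "negligible {t \<in> K. U t = b}"
        using fin ab by (auto intro!: negligible_finite)
    qed
    ultimately have ae: "AE t in lebesgue. ?R t = ?L t" by (auto elim: eventually_mono)
    have int: "integrable lebesgue (\<lambda>t. indicator (G j \<inter> ?J) t *\<^sub>R (?w t * deriv U t))" if "j < d" for j
      using cov(1)[OF that, of "{a<..<b}"] by (simp add: set_integrable_def)
    then have "integrable lebesgue ?R" by (intro Bochner_Integration.integrable_sum) auto
    then have meas: "?R \<in> borel_measurable lebesgue" by (rule borel_measurable_integrable)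
    have "chart_current K \<gamma> \<theta> (\<lambda>_. 1) ?p = integral\<^sup>L lebesgue ?L"
      by (simp add: chart_current_def set_lebesgue_integral_def)
    also have "\<dots> = integral\<^sup>L lebesgue ?R"
    proof (rule integral_cong_AE[OF borel_measurable_AE[OF meas ae] meas])
      show "AE t in lebesgue. ?L t = ?R t" using ae by eventually_elim (rule sym)
    qed
    also have "\<dots> = (\<Sum>j<d. set_lebesgue_integral lebesgue (G j \<inter> ?J) (\<lambda>t. ?w t * deriv U t))"
      using int unfolding set_lebesgue_integral_def by (intro Bochner_Integration.integral_sum) auto
    also have "\<dots> = (\<Sum>j<d. set_lebesgue_integral lebesgue {a<..<b} (\<epsilon> j))"
      using cov(3) by (intro sum.cong) auto
    finally show "chart_current K \<gamma> \<theta> (\<lambda>_. 1) ?p = (\<Sum>j<d. set_lebesgue_integral lebesgue {a<..<b} (\<epsilon> j))" .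
  qed
qed

section \<open>Parity of the multiplicity at a star\<close>

text \<open>
  Intervals generate the Borel sets, so all integrals over Borel sets vanish too.
\<close>

lemma AE_zero_if_interval_integrals_zero:
  fixes f :: "real \<Rightarrow> real"
  assumes int: "integrable lborel f"
    and zero: "\<And>a b. a < b \<Longrightarrow> set_lebesgue_integral lborel {a<..<b} f = 0"
  shows "AE x in lborel. f x = 0"
proof (rule sigma_finite_measure.density_zero[OF sigma_finite_lborel int])
  have gen: "sets borel = sigma_sets UNIV (range (\<lambda>(a, b). {a<..<b::real}))"
    by (subst borel_eq_box) (simp add: case_prod_unfold)
  have si: "set_integrable lborel A f" if "A \<in> sets borel" for A
    unfolding set_integrable_def using int that by (intro integrable_mult_indicator) auto
  fix A :: "real set" assume "A \<in> sets lborel"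
  then have A: "A \<in> sigma_sets UNIV (range (\<lambda>(a, b). {a<..<b}))"
    by (simp add: gen)
  have "Int_stable (range (\<lambda>(a, b). {a<..<b::real}))"
    by (auto simp: Int_stable_def image_iff)
  moreover have "range (\<lambda>(a, b). {a<..<b::real}) \<subseteq> Pow UNIV" by simp
  ultimately show "set_lebesgue_integral lborel A f = 0"
    using A
  proof (induction rule: sigma_sets_induct_disjoint)
    case (basic A)
    then obtain a b where A: "A = {a<..<b}" by auto
    show ?case
    proof (cases "a < b")
      case True
      then show ?thesis unfolding A by (rule zero)
    qed (simp add: A set_lebesgue_integral_def)
  next
    case (compl A)
    then have A: "A \<in> sets borel"
      by (simp add: gen)
    have tot: "set_lebesgue_integral lborel UNIV f = 0"
    proof -
      have "(\<lambda>n. set_lebesgue_integral lborel {-real (Suc n)<..<real (Suc n)} f) \<longlonglongrightarrow>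
          set_lebesgue_integral lborel (\<Union>n. {-real (Suc n)<..<real (Suc n)}) f"
        by (rule set_integral_cont_up) (auto simp: incseq_def si intro: si)
      moreover have "(\<Union>n. {-real (Suc n)<..<real (Suc n)}) = UNIV"
      proof -
        have "\<exists>n. x \<in> {-real (Suc n)<..<real (Suc n)}" for x :: real
          using reals_Archimedean2[of "\<bar>x\<bar>"] by (auto simp: abs_less_iff intro: less_trans) (smt (verit))
        then show ?thesis by blast
      qed
      ultimately show ?thesis by (simp add: zero LIMSEQ_const_iff)
    qed
    have "set_lebesgue_integral lborel ((UNIV - A) \<union> A) f =
        set_lebesgue_integral lborel (UNIV - A) f + set_lebesgue_integral lborel A f"
      using A by (intro set_integral_Un) (auto intro: si)
    then show ?case using tot compl by simp
  next
    case (union A)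
    then have A: "A i \<in> sets borel" for i
      by (auto simp: gen)
    have "set_lebesgue_integral lborel (\<Union>i. A i) f = (\<Sum>i. set_lebesgue_integral lborel (A i) f)"
      using A union by (intro lebesgue_integral_countable_add si) (auto simp: disjoint_family_on_def)
    then show ?case using union by simp
  qed (auto simp: set_lebesgue_integral_def)
qed

lemma AE_zero_if_interval_integrals_zero_lebesgue:
  fixes f :: "real \<Rightarrow> real"
  assumes int: "integrable lebesgue f"
    and zero: "\<And>a b. a < b \<Longrightarrow> set_lebesgue_integral lebesgue {a<..<b} f = 0"
  shows "AE x in lebesgue. f x = 0"
proof -
  obtain g where g: "g \<in> borel_measurable lborel" "AE x in lborel. f x = g x"
    using completion_ex_borel_measurable_real[OF borel_measurable_integrable[OF int]] by blast
  have ae: "AE x in lebesgue. f x = g x" using g(2) by (rule AE_completion)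
  have gm: "g \<in> borel_measurable lebesgue" using g(1) by (rule measurable_completion)
  have "integrable lebesgue g"
    using int integrable_cong_AE[OF borel_measurable_integrable[OF int] gm ae] by blast
  then have gi: "integrable lborel g" using g(1) integrable_completion by blast
  have "AE x in lborel. g x = 0"
  proof (rule AE_zero_if_interval_integrals_zero[OF gi])
    fix a b :: real assume "a < b"
    have "set_lebesgue_integral lborel {a<..<b} g = set_lebesgue_integral lebesgue {a<..<b} g"
      unfolding set_lebesgue_integral_def using g(1)
      by (intro integral_completion[symmetric]) simp
    also have "\<dots> = set_lebesgue_integral lebesgue {a<..<b} f"
      unfolding set_lebesgue_integral_def using gm int
    proof (intro integral_cong_AE)
      show "AE x in lebesgue. indicator {a<..<b} x *\<^sub>R g x = indicator {a<..<b} x *\<^sub>R f x"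
        using ae by eventually_elim simp
    qed (use gm borel_measurable_integrable[OF int] in
          \<open>auto intro!: borel_measurable_times borel_measurable_indicator\<close>)
    finally show "set_lebesgue_integral lborel {a<..<b} g = 0" using zero[OF \<open>a < b\<close>] by simp
  qed
  then have "AE x in lebesgue. g x = 0" by (rule AE_completion)
  with ae show ?thesis by eventually_elim simp
qed

text \<open>
  Such a sum is an integer with the parity of the number of summands.
\<close>

lemma odd_sum_of_signs_nonzero:
  fixes c :: "nat \<Rightarrow> real"
  assumes "odd d" and c: "\<And>j. j < d \<Longrightarrow> \<bar>c j\<bar> = 1"
  shows "(\<Sum>j<d. c j) \<noteq> 0"
proof -
  have "\<exists>z::int. (\<Sum>j<d. c j) = of_int z \<and> (even z \<longleftrightarrow> even d)"
    using c
  proof (induction d)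
    case (Suc d)
    then obtain z :: int where z: "(\<Sum>j<d. c j) = of_int z" "even z \<longleftrightarrow> even d" by fastforce
    have "c d = 1 \<or> c d = - 1" using Suc.prems[of d] by auto
    then show ?case
    proof
      assume "c d = 1"
      then show ?thesis using z by (intro exI[of _ "z + 1"]) auto
    next
      assume "c d = - 1"
      then show ?thesis using z by (intro exI[of _ "z - 1"]) auto
    qed
  qed auto
  then show ?thesis using \<open>odd d\<close> by auto
qed

text \<open>
  The contradiction at one vertex.  At almost every position \<open>s\<close> of arm \<open>j\<close> exactly one chart
  contributes, with a sign \<open>\<Theta> j s\<close>; hence the sum \<open>F s\<close> over the arms is nonzero.  The partial sums
  over the charts are bounded by one, so dominated convergence identifies the integral of \<open>F\<close> over each
  interval with the vanishing value of the current on a cutoff.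
\<close>

lemma no_unit_multiplicity_on_odd_star:
  assumes star: "metric_star v r d \<alpha>" and "odd d"
    and rep: "rectifiable_representation T K \<gamma> \<theta>"
    and m_chart: "\<And>n t. t \<in> K n \<Longrightarrow> m (\<gamma> n t) = nat \<bar>\<theta> n t\<bar>"
    and m_off: "\<And>x. x \<notin> (\<Union>n. \<gamma> n ` K n) \<Longrightarrow> m x = 0"
    and unit: "AE s in lebesgue. \<forall>j<d. 0 < s \<and> s < r \<longrightarrow> m (\<alpha> j s) = 1"
    and lipb: "\<And>a b. radial_cutoff v a b \<in> lip_fun"
    and zero: "\<And>a b. 0 \<le> a \<Longrightarrow> a < b \<Longrightarrow> b \<le> r \<Longrightarrow> T (\<lambda>_. 1) (radial_cutoff v a b) = 0"
  shows False
proof -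
  have "0 < r" using star by (simp add: metric_star_def)
  define Q where "Q n \<epsilon> \<longleftrightarrow> (\<forall>j<d. integrable lebesgue (\<epsilon> j)) \<and>
      (\<forall>j<d. \<forall>s. \<epsilon> j s \<noteq> 0 \<longrightarrow> 0 < s \<and> s < r \<and> \<alpha> j s \<in> \<gamma> n ` K n) \<and>
      (AE s in lebesgue. \<forall>j<d. \<forall>t\<in>K n. 0 < s \<and> s < r \<and> \<gamma> n t = \<alpha> j s \<longrightarrow> \<bar>\<epsilon> j s\<bar> = \<bar>of_int (\<theta> n t)\<bar>) \<and>
      (\<forall>a b. 0 \<le> a \<longrightarrow> a < b \<longrightarrow> b \<le> r \<longrightarrow>
           chart_current (K n) (\<gamma> n) (\<theta> n) (\<lambda>_. 1) (radial_cutoff v a b) =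
             (\<Sum>j<d. set_lebesgue_integral lebesgue {a<..<b} (\<epsilon> j)))"
    for n and \<epsilon> :: "nat \<Rightarrow> real \<Rightarrow> real"
  have "\<exists>\<epsilon>. Q n \<epsilon>" for n
  proof -
    have "compact (K n)" "bilipschitz_on (K n) (\<gamma> n)" "integrable lebesgue (\<lambda>t. real_of_int (\<theta> n t))"
      using rep unfolding rectifiable_representation_def by blast+
    then show ?thesis
    proof (rule chart_current_radial_cutoff[OF star])
      fix \<epsilon> assume *: "\<And>j. j < d \<Longrightarrow> integrable lebesgue (\<epsilon> j)"
        "\<And>j s. j < d \<Longrightarrow> \<epsilon> j s \<noteq> 0 \<Longrightarrow> 0 < s \<and> s < r \<and> \<alpha> j s \<in> \<gamma> n ` K n"
        "AE s in lebesgue. \<forall>j<d. \<forall>t\<in>K n. 0 < s \<and> s < r \<and> \<gamma> n t = \<alpha> j s \<longrightarrow>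
           \<bar>\<epsilon> j s\<bar> = \<bar>of_int (\<theta> n t)\<bar>"
        "\<And>a b. 0 \<le> a \<Longrightarrow> a < b \<Longrightarrow> b \<le> r \<Longrightarrow>
           chart_current (K n) (\<gamma> n) (\<theta> n) (\<lambda>_. 1) (radial_cutoff v a b) =
             (\<Sum>j<d. set_lebesgue_integral lebesgue {a<..<b} (\<epsilon> j))"
      show ?thesis
        unfolding Q_def by (intro exI[of _ \<epsilon>] conjI[OF _ conjI[OF _ conjI]] allI impI *)
    qed
  qed
  then obtain \<epsilon> where Q: "\<And>n. Q n (\<epsilon> n)" by metis
  have int: "integrable lebesgue (\<epsilon> n j)" if "j < d" for n j
    using Q[of n] that unfolding Q_def by blast
  have supp: "0 < s \<and> s < r \<and> \<alpha> j s \<in> \<gamma> n ` K n" if "j < d" "\<epsilon> n j s \<noteq> 0" for n j s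
    using Q[of n] that unfolding Q_def by blast
  have size: "AE s in lebesgue. \<forall>n. \<forall>j<d. \<forall>t\<in>K n. 0 < s \<and> s < r \<and> \<gamma> n t = \<alpha> j s \<longrightarrow>
      \<bar>\<epsilon> n j s\<bar> = \<bar>of_int (\<theta> n t)\<bar>"
    using Q unfolding Q_def AE_all_countable by blast
  have chart: "chart_current (K n) (\<gamma> n) (\<theta> n) (\<lambda>_. 1) (radial_cutoff v a b) =
      (\<Sum>j<d. set_lebesgue_integral lebesgue {a<..<b} (\<epsilon> n j))"
    if "0 \<le> a" "a < b" "b \<le> r" for n a b
    using Q[of n] that unfolding Q_def by blast
  have disj: "disjoint_family (\<lambda>n. \<gamma> n ` K n)"
    using rep unfolding rectifiable_representation_def by blast

  have single: "AE s in lebesgue. \<forall>j<d. 0 < s \<and> s < r \<longrightarrow>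
      (\<exists>k. \<bar>\<epsilon> k j s\<bar> = 1 \<and> (\<forall>n. n \<noteq> k \<longrightarrow> \<epsilon> n j s = 0))"
    using size unit
  proof (eventually_elim, intro allI impI)
    fix s j
    assume size: "\<forall>n. \<forall>j<d. \<forall>t\<in>K n. 0 < s \<and> s < r \<and> \<gamma> n t = \<alpha> j s \<longrightarrow> \<bar>\<epsilon> n j s\<bar> = \<bar>of_int (\<theta> n t)\<bar>"
      and unit: "\<forall>j<d. 0 < s \<and> s < r \<longrightarrow> m (\<alpha> j s) = 1" and j: "j < d" and s: "0 < s \<and> s < r"
    have m1: "m (\<alpha> j s) = 1" using unit j s by blast
    then have "\<alpha> j s \<in> (\<Union>n. \<gamma> n ` K n)" using m_off[of "\<alpha> j s"] by fastforce
    then obtain k t where t: "t \<in> K k" "\<gamma> k t = \<alpha> j s" by auto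
    then have "nat \<bar>\<theta> k t\<bar> = 1" using m_chart[OF t(1)] m1 by simp
    then have "\<bar>\<epsilon> k j s\<bar> = 1" using size j s t by (auto simp: nat_eq_iff simp flip: of_int_abs)
    moreover have "\<epsilon> n j s = 0" if "n \<noteq> k" for n
    proof (rule ccontr)
      assume "\<epsilon> n j s \<noteq> 0"
      then have "\<alpha> j s \<in> \<gamma> n ` K n" using supp[OF j] by blast
      moreover have "\<alpha> j s \<in> \<gamma> k ` K k" using t by (metis imageI)
      ultimately show False using disjoint_family_onD[OF disj _ _ that] by blast
    qed
    ultimately show "\<exists>k. \<bar>\<epsilon> k j s\<bar> = 1 \<and> (\<forall>n. n \<noteq> k \<longrightarrow> \<epsilon> n j s = 0)" by blast
  qed
  define \<Theta> where "\<Theta> j s = (\<Sum>n. \<epsilon> n j s)" for j s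
  have sum: "AE s in lebesgue. \<forall>j<d. (\<lambda>n. \<epsilon> n j s) sums \<Theta> j s \<and>
      (\<forall>N. \<bar>\<Sum>n<N. \<epsilon> n j s\<bar> \<le> indicator {0<..<r} s) \<and> (0 < s \<and> s < r \<longrightarrow> \<bar>\<Theta> j s\<bar> = 1)"
    using single
  proof (eventually_elim, intro allI impI)
    fix s j
    assume single: "\<forall>j<d. 0 < s \<and> s < r \<longrightarrow> (\<exists>k. \<bar>\<epsilon> k j s\<bar> = 1 \<and> (\<forall>n. n \<noteq> k \<longrightarrow> \<epsilon> n j s = 0))"
      and j: "j < d"
    show "(\<lambda>n. \<epsilon> n j s) sums \<Theta> j s \<and> (\<forall>N. \<bar>\<Sum>n<N. \<epsilon> n j s\<bar> \<le> indicator {0<..<r} s) \<and>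
        (0 < s \<and> s < r \<longrightarrow> \<bar>\<Theta> j s\<bar> = 1)"
    proof (cases "0 < s \<and> s < r")
      case False
      then have "\<epsilon> n j s = 0" for n using supp[OF j] by blast
      then show ?thesis using False by (simp add: \<Theta>_def)
    next
      case True
      then obtain k where k: "\<bar>\<epsilon> k j s\<bar> = 1" "\<And>n. n \<noteq> k \<Longrightarrow> \<epsilon> n j s = 0" using single j by blast
      have eq: "(\<lambda>n. \<epsilon> n j s) = (\<lambda>n. if n = k then \<epsilon> k j s else 0)" using k(2) by auto
      have "(\<lambda>n. \<epsilon> n j s) sums \<epsilon> k j s"
        unfolding eq using sums_single[of k "\<lambda>_. \<epsilon> k j s"] by simp
      moreover from this have "\<Theta> j s = \<epsilon> k j s" unfolding \<Theta>_def by (rule sums_unique[symmetric])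
      moreover have "\<bar>\<Sum>n<N. \<epsilon> n j s\<bar> \<le> 1" for N
      proof -
        have "(\<Sum>n<N. \<epsilon> n j s) = (\<Sum>n<N. if n = k then \<epsilon> k j s else 0)"
          using eq by (intro sum.cong) meson+
        also have "\<bar>\<dots>\<bar> \<le> 1" using k(1) by simp
        finally show ?thesis .
      qed
      ultimately show ?thesis using k True by simp
    qed
  qed
  have \<Theta>_meas: "\<Theta> j \<in> borel_measurable lebesgue" if "j < d" for j
    unfolding \<Theta>_def[abs_def] using int[OF that] by (intro borel_measurable_suminf) auto
  have ind: "integrable lebesgue (indicator {0<..<r} :: real \<Rightarrow> real)"
    using \<open>0 < r\<close> by (intro integrable_real_indicator) auto
  have \<Theta>_int: "integrable lebesgue (\<Theta> j)" if j: "j < d" for j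
  proof (rule Bochner_Integration.integrable_bound[OF ind \<Theta>_meas[OF j]])
    show "AE s in lebesgue. norm (\<Theta> j s) \<le> norm (indicator {0<..<r} s :: real)"
      using sum
    proof eventually_elim
      case (elim s)
      have "(\<lambda>N. \<Sum>n<N. \<epsilon> n j s) \<longlonglongrightarrow> \<Theta> j s" using elim j by (simp add: sums_def)
      then have "\<bar>\<Theta> j s\<bar> \<le> indicator {0<..<r} s"
        by (rule tendsto_upperbound[OF tendsto_rabs]) (use elim j in auto)
      then show ?case by simp
    qed
  qed
  have conv: "(\<lambda>N. \<Sum>n<N. set_lebesgue_integral lebesgue {a<..<b} (\<epsilon> n j)) \<longlonglongrightarrow>
      set_lebesgue_integral lebesgue {a<..<b} (\<Theta> j)" if j: "j < d" for a b j
  proof -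
    have si: "integrable lebesgue (\<lambda>s. indicator {a<..<b} s *\<^sub>R \<epsilon> n j s)" for n
      using int[OF j] by (intro integrable_mult_indicator) auto
    have "(\<lambda>N. integral\<^sup>L lebesgue (\<lambda>s. \<Sum>n<N. indicator {a<..<b} s *\<^sub>R \<epsilon> n j s)) \<longlonglongrightarrow>
        integral\<^sup>L lebesgue (\<lambda>s. indicator {a<..<b} s *\<^sub>R \<Theta> j s)"
    proof (rule integral_dominated_convergence[OF _ _ ind])
      show "(\<lambda>s. indicator {a<..<b} s *\<^sub>R \<Theta> j s) \<in> borel_measurable lebesgue"
        using \<Theta>_meas[OF j] by (intro borel_measurable_scaleR borel_measurable_indicator) auto
      show "(\<lambda>s. \<Sum>n<N. indicator {a<..<b} s *\<^sub>R \<epsilon> n j s) \<in> borel_measurable lebesgue" for N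
        using si by (intro borel_measurable_sum borel_measurable_integrable)
      show "AE s in lebesgue. (\<lambda>N. \<Sum>n<N. indicator {a<..<b} s *\<^sub>R \<epsilon> n j s) \<longlonglongrightarrow>
          indicator {a<..<b} s *\<^sub>R \<Theta> j s"
        using sum
      proof eventually_elim
        case (elim s)
        then have "(\<lambda>n. indicator {a<..<b} s *\<^sub>R \<epsilon> n j s) sums (indicator {a<..<b} s *\<^sub>R \<Theta> j s)"
          using j by (intro sums_scaleR_right) blast
        then show ?case by (simp add: sums_def)
      qed
      show "AE s in lebesgue. norm (\<Sum>n<N. indicator {a<..<b} s *\<^sub>R \<epsilon> n j s) \<le> indicator {0<..<r} s" for N
        using sum
      proof eventually_elim
        case (elim s)
        have "norm (\<Sum>n<N. indicator {a<..<b} s *\<^sub>R \<epsilon> n j s) =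
            indicator {a<..<b} s * \<bar>\<Sum>n<N. \<epsilon> n j s\<bar>"
          by (simp add: abs_mult flip: sum_distrib_left)
        also have "\<dots> \<le> 1 * \<bar>\<Sum>n<N. \<epsilon> n j s\<bar>" by (intro mult_right_mono) (auto simp: indicator_def)
        also have "\<dots> \<le> indicator {0<..<r} s" using elim j by simp
        finally show ?case .
      qed
    qed
    then show ?thesis
      using si by (simp only: set_lebesgue_integral_def Bochner_Integration.integral_sum)
  qed
  define F where "F s = (\<Sum>j<d. \<Theta> j s)" for s
  have F_int: "integrable lebesgue F"
    unfolding F_def[abs_def] using \<Theta>_int by (intro Bochner_Integration.integrable_sum) auto
  have F_zero': "set_lebesgue_integral lebesgue {a<..<b} F = 0" if ab: "0 \<le> a" "a < b" "b \<le> r" for a b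
  proof -
    have one: "(\<lambda>_. 1) \<in> lip_bounded"
      unfolding lip_bounded_def lip_fun_def by (auto intro!: exI[of _ 0] lipschitz_onI)
    have "\<forall>f\<in>lip_bounded. \<forall>p\<in>lip_fun.
        (\<lambda>n. chart_current (K n) (\<gamma> n) (\<theta> n) f p) sums T f p"
      using rep unfolding rectifiable_representation_def by blast
    from bspec[OF bspec[OF this one] lipb[of a b]]
    have "(\<lambda>n. chart_current (K n) (\<gamma> n) (\<theta> n) (\<lambda>_. 1) (radial_cutoff v a b)) sums 0"
      unfolding zero[OF ab] .
    then have "(\<lambda>N. \<Sum>j<d. \<Sum>n<N. set_lebesgue_integral lebesgue {a<..<b} (\<epsilon> n j)) \<longlonglongrightarrow> 0"
      unfolding sums_def chart[OF ab] by (subst sum.swap)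
    moreover have "(\<lambda>N. \<Sum>j<d. \<Sum>n<N. set_lebesgue_integral lebesgue {a<..<b} (\<epsilon> n j)) \<longlonglongrightarrow>
        (\<Sum>j<d. set_lebesgue_integral lebesgue {a<..<b} (\<Theta> j))"
      using conv by (intro tendsto_sum) auto
    ultimately have "(\<Sum>j<d. set_lebesgue_integral lebesgue {a<..<b} (\<Theta> j)) = 0"
      using LIMSEQ_unique by blast
    also have "(\<Sum>j<d. set_lebesgue_integral lebesgue {a<..<b} (\<Theta> j)) = set_lebesgue_integral lebesgue {a<..<b} F"
    proof -
      have "integrable lebesgue (\<lambda>s. indicator {a<..<b} s *\<^sub>R \<Theta> j s)" if "j < d" for j
        using \<Theta>_int[OF that] by (intro integrable_mult_indicator) auto
      then show ?thesis
        unfolding set_lebesgue_integral_def F_def scaleR_sum_right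
        by (intro Bochner_Integration.integral_sum[symmetric]) auto
    qed
    finally show ?thesis .
  qed
  have F_off: "F s = 0" if "\<not> (0 < s \<and> s < r)" for s
  proof -
    have "\<epsilon> n j s = 0" if "j < d" for n j using supp[OF that] \<open>\<not> (0 < s \<and> s < r)\<close> by blast
    then show ?thesis by (simp add: F_def \<Theta>_def)
  qed
  have "AE s in lebesgue. F s = 0"
  proof (rule AE_zero_if_interval_integrals_zero_lebesgue[OF F_int])
    fix a b :: real assume "a < b"
    \<comment> \<open>\<open>F\<close> vanishes off the range \<open>0 < s < r\<close> of the cutoffs.\<close>
    have eq: "(\<lambda>s. indicator {a<..<b} s *\<^sub>R F s) = (\<lambda>s. indicator {max a 0<..<min b r} s *\<^sub>R F s)"
      using F_off by (auto simp: fun_eq_iff indicator_def)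
    show "set_lebesgue_integral lebesgue {a<..<b} F = 0"
    proof (cases "max a 0 < min b r")
      case True
      then show ?thesis
        using F_zero'[of "max a 0" "min b r"] eq by (simp add: set_lebesgue_integral_def)
    next
      case False
      then have "{max a 0<..<min b r} = {}" by auto
      then show ?thesis unfolding set_lebesgue_integral_def eq by simp
    qed
  qed
  with sum have "AE s in lebesgue. s \<notin> {0<..<r}"
  proof eventually_elim
    case (elim s)
    show ?case
    proof
      assume "s \<in> {0<..<r}"
      then have "F s \<noteq> 0"
        unfolding F_def using elim(1) by (intro odd_sum_of_signs_nonzero[OF \<open>odd d\<close>]) auto
      then show False using elim(2) by simp
    qed
  qed
  then have "emeasure lebesgue {0<..<r} = 0"
    by (subst (asm) AE_iff_measurable[of "{0<..<r}"]) auto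
  then show False using \<open>0 < r\<close> by simp
qed

section \<open>Arms and edges at an isolated vertex\<close>

lemma open_edge_subset_edge: "e i ` {0<..<len i} \<subseteq> edge len e i"
  unfolding edge_def by (intro image_mono) auto

lemma chain_length_nonneg: "chain I len e x y L \<Longrightarrow> 0 \<le> L"
  by (induction rule: chain.induct) auto

lemma chain_endpoint:
  "chain I len e x y L \<Longrightarrow> x \<in> \<Union>(edge len e ` I) \<Longrightarrow> y \<in> \<Union>(edge len e ` I)"
  unfolding edge_def by (induction rule: chain.induct) blast+

lemma dist_le_chain_length:
  assumes G: "graph_like_space I len e" and x: "x \<in> \<Union>(edge len e ` I)" and c: "chain I len e x y L"
  shows "dist x y \<le> L"
proof -
  have "dist x y = Inf {L. chain I len e x y L}"
    using G x chain_endpoint[OF c x] unfolding graph_like_space_def by blast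
  also have "\<dots> \<le> L"
    using c by (intro cInf_lower bdd_belowI[of _ 0]) (auto simp: chain_length_nonneg)
  finally show ?thesis .
qed

lemma compact_edge:
  assumes G: "graph_like_space I len e" and i: "i \<in> I"
  shows "compact (edge len e i)"
proof -
  have "dist (e i s) (e i t) \<le> \<bar>s - t\<bar>" if "s \<in> {0..len i}" "t \<in> {0..len i}" for s t
  proof (rule dist_le_chain_length[OF G])
    show "chain I len e (e i s) (e i t) \<bar>s - t\<bar>"
      using chain.step[OF chain.refl[of I len e "e i s"] i that] by (simp add: abs_minus_commute)
  qed (use i that(1) in \<open>unfold edge_def, blast\<close>)
  then have "1-lipschitz_on {0..len i} (e i)"
    by (intro lipschitz_onI) (auto simp: dist_real_def)
  then show ?thesis
    unfolding edge_def by (intro compact_continuous_image lipschitz_on_continuous_on) auto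
qed

text \<open>
  A chain can leave an open edge only through one of its endpoints, and these are vertices, which
  are too far away to be reached.
\<close>

lemma chain_stays_in_open_edge:
  assumes G: "graph_like_space I len e" and i: "i \<in> I"
    and x: "x \<in> e i ` {0<..<len i}" and c: "chain I len e x y L"
    and far: "\<And>w. w \<in> vertices I len e \<Longrightarrow> L < dist x w"
  shows "y \<in> e i ` {0<..<len i}"
  using c x far
proof (induction rule: chain.induct)
  case (step x k s L t)
  have clear: "e j ` {0<..<len j} \<inter> vertices I len e = {}" if "j \<in> I" for j
    using G that unfolding graph_like_space_def by blast
  have "L < dist x w" if "w \<in> vertices I len e" for w
    using step.prems(2)[OF that] by linarith
  then have s: "e k s \<in> e i ` {0<..<len i}"
    using step.IH step.prems(1) by blast
  have "s \<noteq> 0" "s \<noteq> len k"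
    using s clear[OF i] \<open>k \<in> I\<close> by (auto simp: vertices_def)
  then have "e k s \<in> e k ` {0<..<len k}" using \<open>s \<in> {0..len k}\<close> by auto
  then have "k = i"
    using s G i \<open>k \<in> I\<close> unfolding graph_like_space_def disjoint_family_on_def by blast
  have xc: "x \<in> \<Union>(edge len e ` I)" 
    using subsetD[OF open_edge_subset_edge[of e i len] step.prems(1)] by (rule UN_I[OF i])
  have "chain I len e x (e k t) (L + \<bar>s - t\<bar>)"
    using chain.step[OF step.hyps] .
  then have "dist x (e k t) \<le> L + \<bar>s - t\<bar>"
    using dist_le_chain_length[OF G xc] by blast
  then have "e k t \<notin> vertices I len e"
    using step.prems(2)[of "e k t"] by auto
  then have "t \<noteq> 0" "t \<noteq> len k" using \<open>k \<in> I\<close> by (auto simp: vertices_def)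
  then show ?case using \<open>t \<in> {0..len k}\<close> \<open>k = i\<close> by auto
qed simp

text \<open>
  Points of the completion count as well: a ball around \<open>x\<close> free of vertices contains a point \<open>y\<close> of
  the complex, all points of the complex near \<open>y\<close> lie on the edge of \<open>y\<close> by the preceding lemma, and
  that edge is compact, so that the completion adds no points there.
\<close>

lemma open_edge_neighbourhood:
  assumes G: "graph_like_space I len e"
    and x: "x \<notin> vertices I len e" "\<not> x islimpt vertices I len e"
  obtains i W where "i \<in> I" "open W" "x \<in> W" "W \<subseteq> e i ` {0<..<len i}"
proof -
  let ?X = "\<Union>(edge len e ` I)" and ?V = "vertices I len e"
  have "x \<notin> closure ?V" using x by (simp add: closure_def)
  then obtain \<delta> where "\<delta> > 0" and \<delta>: "ball x \<delta> \<subseteq> - closure ?V"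
    using open_contains_ball[of "- closure ?V"] by auto
  have free: "w \<notin> ball x \<delta>" if "w \<in> ?V" for w
    using \<delta> that closure_subset by blast
  have "x \<in> closure ?X" using G unfolding graph_like_space_def by blast
  then obtain y where y: "y \<in> ?X" "dist y x < \<delta>/2"
    using \<open>\<delta> > 0\<close> unfolding closure_approachable by (meson half_gt_zero)
  have far: "\<delta>/2 \<le> dist y w" if "w \<in> ?V" for w
    using free[OF that] y(2) dist_triangle[of x w y] by (auto simp: dist_commute)
  obtain i s where i: "i \<in> I" "s \<in> {0..len i}" "y = e i s" using y(1) by (auto simp: edge_def)
  have "y \<notin> ?V" using free[of y] y(2) \<open>\<delta> > 0\<close> by (auto simp: dist_commute)
  then have "s \<noteq> 0" "s \<noteq> len i" using i by (auto simp: vertices_def)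
  then have yi: "y \<in> e i ` {0<..<len i}" using i by auto
  have near: "z \<in> e i ` {0<..<len i}" if z: "z \<in> ?X" "dist y z < \<delta>/2" for z
  proof -
    have "{L. chain I len e y z L} \<noteq> {}" "dist y z = Inf {L. chain I len e y z L}"
      using G y(1) z(1) unfolding graph_like_space_def by blast+
    then obtain L where L: "chain I len e y z L" "L < \<delta>/2"
      using z(2) cInf_lessD[of "{L. chain I len e y z L}" "\<delta>/2"] by auto
    show ?thesis
      by (rule chain_stays_in_open_edge[OF G i(1) yi L(1)]) (use far L(2) in force)
  qed
  have "ball y (\<delta>/2) \<subseteq> closure (ball y (\<delta>/2) \<inter> ?X)"
    using open_Int_closure_subset[of "ball y (\<delta>/2)" ?X] G unfolding graph_like_space_def by auto
  also have "\<dots> \<subseteq> closure (edge len e i)"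
    using near by (intro closure_mono) (fastforce simp: edge_def)
  also have "\<dots> = edge len e i"
    using compact_edge[OF G i(1)] by (simp add: compact_imp_closed)
  finally have *: "ball y (\<delta>/2) \<subseteq> edge len e i" .
  show ?thesis
  proof (rule that[OF i(1)])
    show "open (ball y (\<delta>/2))" "x \<in> ball y (\<delta>/2)" using y(2) by auto
    show "ball y (\<delta>/2) \<subseteq> e i ` {0<..<len i}"
    proof
      fix z assume z: "z \<in> ball y (\<delta>/2)"
      then obtain t where t: "t \<in> {0..len i}" "z = e i t" using * by (auto simp: edge_def)
      have "z \<notin> ?V" using far[of z] z by auto
      then have "t \<noteq> 0" "t \<noteq> len i" using i(1) t by (auto simp: vertices_def)
      then show "z \<in> e i ` {0<..<len i}" using t by auto
    qed
  qed
qed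

text \<open>
  Away from \<open>v\<close> the arm runs through the disjoint open edges only, so by connectedness it stays in a
  single one.  The closed edge then contains \<open>v\<close> as a limit point of the arm, and a vertex on an edge is an endpoint.
\<close>

lemma arm_in_incident_edge:
  fixes \<alpha> :: "real \<Rightarrow> 'a::complete_space"
  assumes G: "graph_like_space I len e" and v: "v \<in> vertices I len e"
    and "0 < \<rho>" and cont: "continuous_on {0..\<rho>} \<alpha>" and "\<alpha> 0 = v"
    and nv: "\<And>s. 0 < s \<Longrightarrow> s \<le> \<rho> \<Longrightarrow> \<alpha> s \<notin> vertices I len e \<and> \<not> \<alpha> s islimpt vertices I len e"
  obtains i where "i \<in> I" "incident len e i v" "\<alpha> ` {0..\<rho>} \<subseteq> edge len e i"
proof -
  define W where "W i = interior (e i ` {0<..<len i})" for i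
  have conn: "connected (\<alpha> ` {0<..\<rho>})"
    by (intro connected_continuous_image continuous_on_subset[OF cont]) auto
  have cover: "\<exists>i\<in>I. x \<in> W i" if x: "x \<in> \<alpha> ` {0<..\<rho>}" for x
  proof -
    obtain s where s: "0 < s" "s \<le> \<rho>" "x = \<alpha> s" using x by auto
    obtain i U where "i \<in> I" "open U" "x \<in> U" "U \<subseteq> e i ` {0<..<len i}"
      using open_edge_neighbourhood[OF G, of x] nv[OF s(1,2)] s(3) by blast
    then show ?thesis unfolding W_def by (blast intro: interiorI)
  qed
  have "\<alpha> \<rho> \<in> \<alpha> ` {0<..\<rho>}" using \<open>0 < \<rho>\<close> by auto
  then obtain i where i: "i \<in> I" "\<alpha> \<rho> \<in> W i" using cover by blast
  have disj: "W i \<inter> W k = {}" if "k \<in> I" "k \<noteq> i" for k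
  proof -
    have "disjoint_family_on (\<lambda>i. e i ` {0<..<len i}) I"
      using G unfolding graph_like_space_def by blast
    then have "e i ` {0<..<len i} \<inter> e k ` {0<..<len k} = {}"
      using disjoint_family_onD[OF _ i(1) that(1)] that(2) by blast
    then show ?thesis
      using interior_subset[of "e i ` {0<..<len i}"] interior_subset[of "e k ` {0<..<len k}"]
      unfolding W_def by blast
  qed
  have "\<alpha> ` {0<..\<rho>} \<inter> (\<Union>k\<in>I-{i}. W k) = {}"
  proof (rule ccontr)
    assume "\<not> ?thesis"
    moreover have "\<alpha> ` {0<..\<rho>} \<subseteq> W i \<union> (\<Union>k\<in>I-{i}. W k)" using cover by blast
    moreover have "open (W i)" "open (\<Union>k\<in>I-{i}. W k)" by (auto simp: W_def)
    moreover have "W i \<inter> (\<Union>k\<in>I-{i}. W k) \<inter> \<alpha> ` {0<..\<rho>} = {}" using disj by blast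
    moreover have "W i \<inter> \<alpha> ` {0<..\<rho>} \<noteq> {}" using i \<open>\<alpha> \<rho> \<in> \<alpha> ` {0<..\<rho>}\<close> by blast
    ultimately show False using conn unfolding connected_def by blast
  qed
  then have "\<alpha> ` {0<..\<rho>} \<subseteq> W i" using cover by blast
  then have sub: "\<alpha> ` {0<..\<rho>} \<subseteq> edge len e i"
    using interior_subset[of "e i ` {0<..<len i}"] unfolding W_def edge_def by fastforce
  have "closed (edge len e i)" using compact_edge[OF G i(1)] by (rule compact_imp_closed)
  have "\<alpha> ` {0..\<rho>} \<subseteq> edge len e i"
  proof -
    have "closure {0<..\<rho>} = {0..\<rho>}" using \<open>0 < \<rho>\<close> by (rule closure_greaterThanAtMost)
    then show ?thesis
      using image_closure_subset[of "{0<..\<rho>}" \<alpha> "edge len e i"] cont sub \<open>closed (edge len e i)\<close>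
      by simp
  qed
  moreover from this have "incident len e i v"
  proof -
    have "v \<in> edge len e i" using calculation \<open>\<alpha> 0 = v\<close> \<open>0 < \<rho>\<close> by fastforce
    then obtain s where s: "s \<in> {0..len i}" "v = e i s" by (auto simp: edge_def)
    have "v \<notin> e i ` {0<..<len i}" using G i(1) v unfolding graph_like_space_def by blast
    then have "s = 0 \<or> s = len i" using s by force
    then show ?thesis using s by (auto simp: incident_def)
  qed
  ultimately show ?thesis using that i(1) by blast
qed

text \<open>
  The arms of an isolated vertex, shortened to a length \<open>r\<close> such that the ball of radius \<open>r\<close> lies in
  the star neighbourhood.  The longer arms, up to \<open>\<rho>\<close>, avoid vertices and limits of vertices.
\<close>

lemma isolated_vertex_metric_star:
  assumes "isolated_vertex I len e v d" and "0 < d" and "0 < \<delta>"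
  obtains \<rho> r \<alpha> where "0 < \<rho>" "r \<le> \<rho>" "r < \<delta>" "metric_star v r d \<alpha>"
    and "\<And>j. j < d \<Longrightarrow> \<alpha> j 0 = v"
    and "\<And>j s t. j < d \<Longrightarrow> s \<in> {0..\<rho>} \<Longrightarrow> t \<in> {0..\<rho>} \<Longrightarrow> dist (\<alpha> j s) (\<alpha> j t) = \<bar>s - t\<bar>"
    and "\<And>j s. j < d \<Longrightarrow> 0 < s \<Longrightarrow> s \<le> \<rho> \<Longrightarrow>
           \<alpha> j s \<notin> vertices I len e \<and> \<not> \<alpha> j s islimpt vertices I len e"
proof -
  obtain \<rho> \<alpha> N where \<rho>: "0 < \<rho>" and N: "N = insert v (\<Union>j<d. \<alpha> j ` {0..\<rho>})"
      "v \<in> interior N" "N \<inter> vertices I len e = {v}" "\<forall>x\<in>N. \<not> x islimpt vertices I len e"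
    and arms: "\<forall>j<d. \<alpha> j 0 = v \<and>
        (\<forall>s\<in>{0..\<rho>}. \<forall>t\<in>{0..\<rho>}. dist (\<alpha> j s) (\<alpha> j t) = \<bar>s - t\<bar>)"
    and meets: "\<forall>j<d. \<forall>k<d. j \<noteq> k \<longrightarrow> \<alpha> j ` {0..\<rho>} \<inter> \<alpha> k ` {0..\<rho>} = {v}"
    using assms(1) unfolding isolated_vertex_def by (elim conjE exE)
  have \<alpha>0: "\<alpha> j 0 = v" if "j < d" for j
    using arms that by blast
  have iso: "dist (\<alpha> j s) (\<alpha> j t) = \<bar>s - t\<bar>" if "j < d" "s \<in> {0..\<rho>}" "t \<in> {0..\<rho>}" for j s t
    using arms that by blast
  have meet: "\<alpha> j ` {0..\<rho>} \<inter> \<alpha> k ` {0..\<rho>} = {v}" if "j < d" "k < d" "j \<noteq> k" for j k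
    using meets that by blast
  obtain R where R: "R > 0" "ball v R \<subseteq> N"
    using N(2) by (meson mem_interior)
  define r where "r = min (min (R/2) (\<delta>/2)) \<rho>"
  have r: "0 < r" "r < R" "r < \<delta>" "r \<le> \<rho>" using R(1) \<rho> \<open>0 < \<delta>\<close> by (auto simp: r_def)
  have rad: "dist v (\<alpha> j s) = s" if "j < d" "s \<in> {0..\<rho>}" for j s
    using iso[OF that(1), of 0 s] \<alpha>0[OF that(1)] that(2) \<rho> by auto
  have notv: "\<alpha> j s \<noteq> v" if "j < d" "0 < s" "s \<le> \<rho>" for j s
    using rad[of j s] that by auto
  have "metric_star v r d \<alpha>"
    unfolding metric_star_def
  proof (intro conjI allI impI ballI)
    fix j assume j: "j < d"
    show "continuous_on {0..r} (\<alpha> j)"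
      using iso[OF j] r by (intro lipschitz_on_continuous_on[of 1] lipschitz_onI) (auto simp: dist_real_def)
    show "dist v (\<alpha> j s) = s" if "s \<in> {0..r}" for s using rad[OF j] that r by auto
    show "j = k" if "k < d" "s \<in> {0<..r}" "t \<in> {0..r}" "\<alpha> j s = \<alpha> k t" for k s t
    proof (rule ccontr)
      assume "j \<noteq> k"
      have "\<alpha> j s \<in> \<alpha> j ` {0..\<rho>}" using that(2) r by auto
      moreover have "\<alpha> j s \<in> \<alpha> k ` {0..\<rho>}" using that(3) r unfolding that(4) by auto
      ultimately have "\<alpha> j s = v" using meet[OF j that(1) \<open>j \<noteq> k\<close>] by blast
      then show False using notv[OF j, of s] that(2) r by auto
    qed
  next
    fix x assume x: "dist v x \<le> r"
    show "\<exists>j<d. \<exists>s\<in>{0..r}. x = \<alpha> j s"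
    proof (cases "x = v")
      case True
      then show ?thesis using \<alpha>0[OF \<open>0 < d\<close>] \<open>0 < d\<close> r by (intro exI[of _ 0] conjI bexI[of _ 0]) auto
    next
      case False
      have "x \<in> N" using x r R by auto
      then obtain j s where js: "j < d" "s \<in> {0..\<rho>}" "x = \<alpha> j s" using False N(1) by blast
      then have "s \<in> {0..r}" using rad[OF js(1,2)] x by auto
      then show ?thesis using js by blast
    qed
  qed (rule r)
  moreover have "\<alpha> j s \<notin> vertices I len e \<and> \<not> \<alpha> j s islimpt vertices I len e"
    if "j < d" "0 < s" "s \<le> \<rho>" for j s
  proof -
    have "s \<in> {0..\<rho>}" using that by simp
    then have "\<alpha> j s \<in> N" unfolding N(1) using that(1) by blast
    then show ?thesis using N(3,4) notv[OF that] by blast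
  qed
  ultimately show ?thesis using that \<rho> r iso \<alpha>0 by blast
qed

text \<open>
  Pulling a cover of \<open>B\<close> back along an isometric arm produces sets of the same or smaller diameter, each
  inside an interval of twice its diameter.
\<close>

lemma negligible_hausdorff1_preimage:
  fixes \<alpha> :: "real \<Rightarrow> 'a::metric_space"
  assumes B: "hausdorff1 B = 0"
    and iso: "\<And>s t. s \<in> A \<Longrightarrow> t \<in> A \<Longrightarrow> dist (\<alpha> s) (\<alpha> t) = \<bar>s - t\<bar>"
  shows "negligible {s \<in> A. \<alpha> s \<in> B}"
proof -
  have "\<exists>T. {s \<in> A. \<alpha> s \<in> B} \<subseteq> T \<and> T \<in> lmeasurable \<and> measure lebesgue T \<le> e" if "e > 0" for e
  proof -
    have "hausdorff1_size 1 B = 0"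
      using B SUP_upper[of 1 "{0<..}" "\<lambda>\<delta>. hausdorff1_size \<delta> B"] by (simp add: hausdorff1_def)
    then have "hausdorff1_size 1 B < ennreal (e/2)" using that by simp
    then obtain U :: "nat \<Rightarrow> 'a set" where U: "B \<subseteq> (\<Union>n. U n)" "\<And>n. bounded (U n)"
      "(\<Sum>n. ennreal (diameter (U n))) < ennreal (e/2)"
      unfolding hausdorff1_size_def INF_less_iff by auto
    define P where "P n s \<longleftrightarrow> s \<in> A \<and> \<alpha> s \<in> U n" for n s
    define T where "T n = (if \<exists>s. P n s then cball (SOME s. P n s) (diameter (U n)) else {})" for n
    have cover: "s \<in> T n" if "P n s" for n s
    proof -
      have *: "P n (SOME s. P n s)" using that by (rule someI)
      then have "dist (\<alpha> (SOME s. P n s)) (\<alpha> s) \<le> diameter (U n)"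
        using that U(2) diameter_bounded_bound by (auto simp: P_def)
      then have "dist (SOME s. P n s) s \<le> diameter (U n)"
        using iso * that by (simp add: P_def dist_real_def)
      then show ?thesis using that by (auto simp: T_def)
    qed
    have d0: "diameter (U n) \<ge> 0" for n using U(2) diameter_ge_0 by blast
    have "emeasure lborel (T n) \<le> 2 * ennreal (diameter (U n))" for n
      using d0[of n] by (auto simp: T_def cball_eq_atLeastAtMost ennreal_mult[symmetric] simp flip: ennreal_numeral)
    then have "(\<Sum>n. emeasure lborel (T n)) \<le> (\<Sum>n. 2 * ennreal (diameter (U n)))"
      by (intro suminf_le) auto
    also have "\<dots> = 2 * (\<Sum>n. ennreal (diameter (U n)))" by (simp add: ennreal_suminf_cmult)
    also have "\<dots> \<le> 2 * ennreal (e/2)" using U(3) by (intro mult_left_mono) auto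
    also have "\<dots> = ennreal e" using that by (simp add: ennreal_mult[symmetric] flip: ennreal_numeral)
    finally have sum: "(\<Sum>n. emeasure lborel (T n)) \<le> ennreal e" .
    have meas: "T n \<in> sets borel" for n by (auto simp: T_def)
    have le: "emeasure lebesgue (\<Union>n. T n) \<le> ennreal e"
      using sum emeasure_subadditive_countably[of T lborel] meas
      by (simp add: image_subset_iff)
    have fm: "(\<Union>n. T n) \<in> lmeasurable"
      using le meas by (intro fmeasurableI) (auto simp: less_top[symmetric] top_unique)
    moreover have "measure lebesgue (\<Union>n. T n) \<le> e"
      using le fm that by (simp add: emeasure_eq_measure2)
    moreover have "{s \<in> A. \<alpha> s \<in> B} \<subseteq> (\<Union>n. T n)"
      using U(1) cover by (fastforce simp: P_def)
    ultimately show ?thesis by blast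
  qed
  then show ?thesis by (auto simp: negligible_outer_le)
qed

section \<open>Integral currents with unit multiplicity at odd vertices\<close>

text \<open>
  Testing against the constant function one shows that the coefficients are summable.  Being
  integers, all but finitely many of them are zero.
\<close>

lemma integer_rectifiable0_finite_support:
  fixes T :: "'a::metric_space current0"
  assumes "integer_rectifiable0 T"
  obtains F where "finite F" "\<And>f. f \<in> lip_bounded \<Longrightarrow> (\<And>x. x \<in> F \<Longrightarrow> f x = 0) \<Longrightarrow> T f = 0"
proof -
  obtain A \<theta> where A: "\<And>f. f \<in> lip_bounded \<Longrightarrow> ((\<lambda>x. real_of_int (\<theta> x) * f x) has_sum T f) A"
    using assms unfolding integer_rectifiable0_def by blast
  have one: "(\<lambda>_. 1) \<in> lip_bounded"
    unfolding lip_bounded_def lip_fun_def by (auto intro!: exI[of _ 0] lipschitz_onI)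
  have "(\<lambda>x. real_of_int (\<theta> x)) summable_on A"
    using A[OF one] by (auto simp: summable_on_def)
  then have abs: "(\<lambda>x. \<bar>real_of_int (\<theta> x)\<bar>) summable_on A"
    by (metis (mono_tags, lifting) real_norm_def summable_on_cong summable_on_iff_abs_summable_on_real)
  define F where "F = {x \<in> A. \<theta> x \<noteq> 0}"
  have "finite F"
  proof (rule ccontr)
    assume inf: "infinite F"
    obtain N :: nat where N: "infsum (\<lambda>x. \<bar>real_of_int (\<theta> x)\<bar>) A < real N"
      using reals_Archimedean2 by blast
    obtain G where G: "G \<subseteq> F" "finite G" "card G = N"
      using infinite_arbitrarily_large[OF inf] by blast
    have "real N = (\<Sum>x\<in>G. 1)" using G by simp
    also have "\<dots> \<le> (\<Sum>x\<in>G. \<bar>real_of_int (\<theta> x)\<bar>)"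
      using G by (intro sum_mono) (auto simp: F_def)
    also have "\<dots> \<le> infsum (\<lambda>x. \<bar>real_of_int (\<theta> x)\<bar>) A"
      using G abs by (intro finite_sum_le_infsum) (auto simp: F_def)
    finally show False using N by simp
  qed
  moreover have "T f = 0" if f: "f \<in> lip_bounded" "\<And>x. x \<in> F \<Longrightarrow> f x = 0" for f
  proof -
    have "real_of_int (\<theta> x) * f x = 0" if "x \<in> A" for x
      using f(2)[of x] that by (auto simp: F_def)
    then have "((\<lambda>x. real_of_int (\<theta> x) * f x) has_sum 0) A"
      by (rule has_sum_0)
    then show ?thesis using A[OF f(1)] has_sum_unique by blast
  qed
  ultimately show ?thesis using that by blast
qed

theorem corollary3p2:
  fixes I :: "nat set" and len :: "nat \<Rightarrow> real"
    and e :: "nat \<Rightarrow> real \<Rightarrow> 'a::complete_space"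
    and v :: "nat \<Rightarrow> 'a" and d :: "nat \<Rightarrow> nat"
  assumes "graph_like_space I len e"
    and "inj v"
    and "\<And>k. isolated_vertex I len e (v k) (d k)"
    and "\<And>k. odd (d k)"
  shows "\<not> (\<exists>(S :: 'a current1) \<theta>. integral_current1 S \<and> has_multiplicity S \<theta> \<and>
           (\<forall>k. \<forall>i\<in>I. incident len e i (v k) \<longrightarrow>
              hausdorff1 {x \<in> edge len e i. \<theta> x \<noteq> 1} = 0))"
proof
  assume "\<exists>(S :: 'a current1) \<theta>. integral_current1 S \<and> has_multiplicity S \<theta> \<and>
           (\<forall>k. \<forall>i\<in>I. incident len e i (v k) \<longrightarrow>
              hausdorff1 {x \<in> edge len e i. \<theta> x \<noteq> 1} = 0)"
  then obtain S :: "'a current1" and m where S: "integral_current1 S" and m: "has_multiplicity S m"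
    and unit: "\<And>k i. i \<in> I \<Longrightarrow> incident len e i (v k) \<Longrightarrow> hausdorff1 {x \<in> edge len e i. m x \<noteq> 1} = 0"
    by metis
  obtain F where F: "finite F"
      "\<And>f. f \<in> lip_bounded \<Longrightarrow> (\<And>x. x \<in> F \<Longrightarrow> f x = 0) \<Longrightarrow> boundary S f = 0"
    using S integer_rectifiable0_finite_support unfolding integral_current1_def by metis
  have "infinite (range v)" using \<open>inj v\<close> by (rule range_inj_infinite)
  then obtain k where k: "v k \<notin> F" using F(1) finite_subset by (metis rangeE subsetI)
  obtain \<delta> where \<delta>: "\<delta> > 0" "\<And>x. x \<in> F \<Longrightarrow> \<delta> \<le> dist (v k) x"
    using finite_set_avoid[OF F(1), of "v k"] k by metis
  have iso: "isolated_vertex I len e (v k) (d k)" and odd: "odd (d k)" by (fact assms)+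
  have "0 < d k" using odd by (rule odd_pos)
  obtain \<rho> r \<alpha> where \<rho>: "0 < \<rho>" "r \<le> \<rho>" "r < \<delta>" and star: "metric_star (v k) r (d k) \<alpha>"
    and \<alpha>0: "\<And>j. j < d k \<Longrightarrow> \<alpha> j 0 = v k"
    and dist: "\<And>j s t. j < d k \<Longrightarrow> s \<in> {0..\<rho>} \<Longrightarrow> t \<in> {0..\<rho>} \<Longrightarrow> dist (\<alpha> j s) (\<alpha> j t) = \<bar>s - t\<bar>"
    and nv: "\<And>j s. j < d k \<Longrightarrow> 0 < s \<Longrightarrow> s \<le> \<rho> \<Longrightarrow>
           \<alpha> j s \<notin> vertices I len e \<and> \<not> \<alpha> j s islimpt vertices I len e"
    using isolated_vertex_metric_star[OF iso \<open>0 < d k\<close> \<delta>(1)] by metis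
  have "AE s in lebesgue. \<forall>j\<in>{..<d k}. 0 < s \<and> s < r \<longrightarrow> m (\<alpha> j s) = 1"
  proof (rule AE_finite_allI)
    fix j assume "j \<in> {..<d k}"
    then have j: "j < d k" by simp
    have cont: "continuous_on {0..\<rho>} (\<alpha> j)"
      using dist[OF j] by (intro lipschitz_on_continuous_on[of 1] lipschitz_onI) (auto simp: dist_real_def)
    have "v k \<in> vertices I len e" using iso unfolding isolated_vertex_def by blast
    then obtain i where i: "i \<in> I" "incident len e i (v k)" "\<alpha> j ` {0..\<rho>} \<subseteq> edge len e i"
      using arm_in_incident_edge[OF assms(1) _ \<rho>(1) cont \<alpha>0[OF j] nv[OF j]] by metis
    have "negligible {s \<in> {0..\<rho>}. \<alpha> j s \<in> {x \<in> edge len e i. m x \<noteq> 1}}"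
      using unit[OF i(1,2)] dist[OF j] by (rule negligible_hausdorff1_preimage)
    then have "AE s in lebesgue. s \<notin> {s \<in> {0..\<rho>}. \<alpha> j s \<in> {x \<in> edge len e i. m x \<noteq> 1}}"
      by (intro AE_not_in) (simp add: negligible_iff_null_sets)
    then show "AE s in lebesgue. 0 < s \<and> s < r \<longrightarrow> m (\<alpha> j s) = 1"
    proof (eventually_elim, intro impI)
      fix s assume s: "s \<notin> {s \<in> {0..\<rho>}. \<alpha> j s \<in> {x \<in> edge len e i. m x \<noteq> 1}}" "0 < s \<and> s < r"
      then have "s \<in> {0..\<rho>}" using \<rho>(2) by simp
      moreover from this have "\<alpha> j s \<in> edge len e i" using i(3) by blast
      ultimately show "m (\<alpha> j s) = 1" using s(1) by blast
    qed
  qed simp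
  then have arms: "AE s in lebesgue. \<forall>j<d k. 0 < s \<and> s < r \<longrightarrow> m (\<alpha> j s) = 1"
    by (simp only: Ball_def lessThan_iff)
  obtain K \<gamma> \<theta> where rep: "rectifiable_representation S K \<gamma> \<theta>"
    and mult: "\<And>n t. t \<in> K n \<Longrightarrow> m (\<gamma> n t) = nat \<bar>\<theta> n t\<bar>"
      "\<And>x. x \<notin> (\<Union>n. \<gamma> n ` K n) \<Longrightarrow> m x = 0"
    using m unfolding has_multiplicity_def by metis
  have lip: "radial_cutoff (v k) a b \<in> lip_fun" for a b
    using lipschitz_radial_cutoff unfolding lip_fun_def by blast
  show False
  proof (rule no_unit_multiplicity_on_odd_star[OF star odd rep mult arms lip])
    fix a b :: real assume ab: "0 \<le> a" "a < b" "b \<le> r"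
    have "bounded (range (radial_cutoff (v k) a b))"
      unfolding bounded_iff using ab by (intro exI[of _ "b - a"]) (auto simp: radial_cutoff_def)
    moreover have "radial_cutoff (v k) a b x = 0" if "x \<in> F" for x
      using \<delta>(2)[OF that] ab \<rho>(3) by (simp add: radial_cutoff_def)
    ultimately have "boundary S (radial_cutoff (v k) a b) = 0"
      using lip by (intro F(2)) (auto simp: lip_bounded_def)
    then show "S (\<lambda>_. 1) (radial_cutoff (v k) a b) = 0" by (simp add: boundary_def)
  qed
qed

end
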